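(* Let $g\ge 2$ and let $H\subset\mathrm{GSp}_{2g}(\mathbb Z_2)$ be a subgroup such that $H=\pi_{2^\infty\to2}^{-1}(H(2))$ and $H(2)\supset S_{2g+1}$. Then \[ [H,H]=\varphi_{2^\infty\to 2}^{-1}\big([H(2),H(2)]\big). \] Moreover, the homomorphism $H\to H(2)^{\mathrm{ab}}\times\mathbb Z_2^\times$ whose first component is reduction mod 2 followed by abelianization $H(2)\to H(2)^{\mathrm{ab}}$ and whose second component is the multiplier map induces an isomorphism $H^{\mathrm{ab}}\cong H(2)^{\mathrm{ab}}\times\mathbb Z_2^\times$.
   Context: $\pi_{2^\infty\to2}:\mathrm{GSp}_{2g}(\mathbb Z_2)\to\mathrm{GSp}_{2g}(\mathbb Z/2\mathbb Z)$ and $\varphi_{2^\infty\to2}:\mathrm{Sp}_{2g}(\mathbb Z_2)\to\mathrm{Sp}_{2g}(\mathbb Z/2\mathbb Z)$ are reduction maps; $H(2)$ is the image of $H$ mod 2. For a topological group $G$, $[G,G]$ is the closure of the commutator subgroup and $G^{\mathrm{ab}}=G/[G,G]$. The multiplier $\mathrm{mult}(S)$ is the scalar with $\langle Sv,Sw\rangle=\mathrm{mult}(S)\langle v,w\rangle$. The embedding $S_{2g+1}\subset S_{2g+2}\subset\mathrm{Sp}_{2g}(\mathbb Z/2\mathbb Z)$: let $V=\mathbb F_2^{2g+2}$ with the standard dot product, $t=(1,\dots,1)$, $W=t^\perp/\mathrm{span}(t)$ with the induced nondegenerate alternating form; $S_{2g+2}$ acts on $W$ by permuting coordinates, and after identifying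 $W$ symplectically with $\mathbb F_2^{2g}$ (with the mod-2 reduction of the symplectic form) this gives $S_{2g+2}\subset\mathrm{Sp}_{2g}(\mathbb Z/2\mathbb Z)$; $S_{2g+1}$ is the stabilizer of the last coordinate. *)

theory Defs
  imports
    "HOL-Analysis.Analysis"
    "HOL-Algebra.Generated_Groups"
    "HOL-Library.Z2"
begin

(* clashes with the infix closure_of of abstract topology *)
no_notation eq_closure_of (\<open>closure'_of\<index>\<close>)

section \<open>The 2-adic integers\<close>

text \<open>\<open>\<int>\<^sub>2\<close> is the inverse limit of the rings \<open>\<int>/2\<^sup>n\<int>\<close>. Component \<open>n\<close> of a coherent
  sequence is the representative of the residue class in \<open>{0..<2^n}\<close>; the case \<open>m = n\<close> of the
  condition below forces it to be reduced.\<close>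

typedef z2adic = "{x :: nat \<Rightarrow> int. \<forall>m n. m \<le> n \<longrightarrow> x n mod 2 ^ m = x m}"
  morphisms residue_at Abs_z2adic
  by (rule exI[of _ "\<lambda>_. 0"]) simp

setup_lifting type_definition_z2adic

lemma mod_power_two_mod [simp]:
  fixes a :: int
  assumes "m \<le> n"
  shows "a mod 2 ^ n mod 2 ^ m = a mod 2 ^ m"
  using assms by (simp add: mod_mod_cancel le_imp_power_dvd)

instantiation z2adic :: comm_ring_1
begin

lift_definition zero_z2adic :: z2adic is "\<lambda>_. 0" by simp

lift_definition one_z2adic :: z2adic is "\<lambda>n. 1 mod 2 ^ n" by simp

lift_definition plus_z2adic :: "z2adic \<Rightarrow> z2adic \<Rightarrow> z2adic"
  is "\<lambda>x y n. (x n + y n) mod 2 ^ n"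
proof -
  fix x y :: "nat \<Rightarrow> int" and m n :: nat
  assume x: "\<And>m n. m \<le> n \<Longrightarrow> x n mod 2 ^ m = x m"
    and y: "\<And>m n. m \<le> n \<Longrightarrow> y n mod 2 ^ m = y m"
    and mn: "m \<le> n"
  show "(x n + y n) mod 2 ^ n mod 2 ^ m = (x m + y m) mod 2 ^ m"
    using mod_add_eq[of "x n" "2 ^ m" "y n"] mn x[OF mn] y[OF mn] by simp
qed

lift_definition uminus_z2adic :: "z2adic \<Rightarrow> z2adic"
  is "\<lambda>x n. (- x n) mod 2 ^ n"
proof -
  fix x :: "nat \<Rightarrow> int" and m n :: nat
  assume x: "\<And>m n. m \<le> n \<Longrightarrow> x n mod 2 ^ m = x m" and mn: "m \<le> n"
  show "(- x n) mod 2 ^ n mod 2 ^ m = (- x m) mod 2 ^ m"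
    using mod_minus_eq[of "x n" "2 ^ m"] mn x[OF mn] by simp
qed

lift_definition minus_z2adic :: "z2adic \<Rightarrow> z2adic \<Rightarrow> z2adic"
  is "\<lambda>x y n. (x n - y n) mod 2 ^ n"
proof -
  fix x y :: "nat \<Rightarrow> int" and m n :: nat
  assume x: "\<And>m n. m \<le> n \<Longrightarrow> x n mod 2 ^ m = x m"
    and y: "\<And>m n. m \<le> n \<Longrightarrow> y n mod 2 ^ m = y m"
    and mn: "m \<le> n"
  show "(x n - y n) mod 2 ^ n mod 2 ^ m = (x m - y m) mod 2 ^ m"
    using mod_diff_eq[of "x n" "2 ^ m" "y n"] mn x[OF mn] y[OF mn] by simp
qed

lift_definition times_z2adic :: "z2adic \<Rightarrow> z2adic \<Rightarrow> z2adic"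
  is "\<lambda>x y n. (x n * y n) mod 2 ^ n"
proof -
  fix x y :: "nat \<Rightarrow> int" and m n :: nat
  assume x: "\<And>m n. m \<le> n \<Longrightarrow> x n mod 2 ^ m = x m"
    and y: "\<And>m n. m \<le> n \<Longrightarrow> y n mod 2 ^ m = y m"
    and mn: "m \<le> n"
  show "(x n * y n) mod 2 ^ n mod 2 ^ m = (x m * y m) mod 2 ^ m"
    using mod_mult_eq[of "x n" "2 ^ m" "y n"] mn x[OF mn] y[OF mn] by simp
qed

instance
proof
  fix a b c :: z2adic
  show "a * b * c = a * (b * c)"
    by transfer (simp add: fun_eq_iff mod_mult_left_eq mod_mult_right_eq mult.assoc)
  show "a * b = b * a"
    by transfer (simp add: fun_eq_iff mult.commute)
  show "1 * a = a"
    by transfer (simp only: mod_mult_left_eq mult_1 mem_Collect_eq order_refl simp_thms)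
  show "a + b + c = a + (b + c)"
    by transfer (simp add: fun_eq_iff mod_add_left_eq mod_add_right_eq add.assoc)
  show "a + b = b + a"
    by transfer (simp add: fun_eq_iff add.commute)
  show "0 + a = a"
    by transfer simp
  show "- a + a = 0"
    by transfer (simp add: fun_eq_iff mod_add_left_eq)
  show "a - b = a + - b"
    by transfer (simp add: fun_eq_iff mod_add_right_eq)
  show "(a + b) * c = a * c + b * c"
    by transfer (simp add: fun_eq_iff mod_mult_left_eq mod_add_eq distrib_right)
  show "(0 :: z2adic) \<noteq> 1"
    by transfer (auto simp: fun_eq_iff intro!: exI[of _ 1])
qed

end

instantiation z2adic :: topological_space
begin

text \<open>The inverse limit topology: the cosets of \<open>2\<^sup>n\<int>\<^sub>2\<close> form a basis.\<close>

definition open_z2adic :: "z2adic set \<Rightarrow> bool" where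
  "open_z2adic U \<longleftrightarrow>
     (\<forall>x\<in>U. \<exists>n. \<forall>y. residue_at y n = residue_at x n \<longrightarrow> y \<in> U)"

instance
proof
  show "open (UNIV :: z2adic set)"
    by (simp add: open_z2adic_def)
next
  fix S T :: "z2adic set"
  assume S: "open S" and T: "open T"
  show "open (S \<inter> T)"
    unfolding open_z2adic_def
  proof
    fix x assume x: "x \<in> S \<inter> T"
    obtain m where m: "\<And>y. residue_at y m = residue_at x m \<Longrightarrow> y \<in> S"
      using S x unfolding open_z2adic_def by blast
    obtain n where n: "\<And>y. residue_at y n = residue_at x n \<Longrightarrow> y \<in> T"
      using T x unfolding open_z2adic_def by blast
    have coherent: "residue_at z k = residue_at z (max m n) mod 2 ^ k"
      if "k \<le> max m n" for z k
      using residue_at[of z] that by (simp only: mem_Collect_eq)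
    have "y \<in> S \<inter> T" if y: "residue_at y (max m n) = residue_at x (max m n)" for y
    proof
      show "y \<in> S"
        by (rule m) (simp only: coherent[OF max.cobounded1] y)
      show "y \<in> T"
        by (rule n) (simp only: coherent[OF max.cobounded2] y)
    qed
    then show "\<exists>n. \<forall>y. residue_at y n = residue_at x n \<longrightarrow> y \<in> S \<inter> T"
      by blast
  qed
next
  fix K :: "z2adic set set"
  assume K: "\<forall>S\<in>K. open S"
  show "open (\<Union> K)"
    unfolding open_z2adic_def
  proof
    fix x assume "x \<in> \<Union> K"
    then obtain S where S: "S \<in> K" "x \<in> S" by blast
    then obtain n where "\<forall>y. residue_at y n = residue_at x n \<longrightarrow> y \<in> S"
      using K unfolding open_z2adic_def by meson
    then show "\<exists>n. \<forall>y. residue_at y n = residue_at x n \<longrightarrow> y \<in> \<Union> K"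
      using S(1) by (intro exI[of _ n]) auto
  qed
qed

end

definition red2 :: "z2adic \<Rightarrow> bit" where
  "red2 x = of_int (residue_at x 1)"

abbreviation red2_mat :: "z2adic ^ 'n::finite ^ 'm::finite \<Rightarrow> bit ^ 'n ^ 'm" where
  "red2_mat \<equiv> map_matrix red2"

definition z2_units :: "z2adic monoid" where
  "z2_units = \<lparr>carrier = {u. u dvd 1}, mult = (*), one = 1\<rparr>"

abbreviation z2_units_topology :: "z2adic topology" where
  "z2_units_topology \<equiv> top_of_set (carrier z2_units)"


section \<open>Symplectic similitudes\<close>

text \<open>Vectors of \<open>R\<^sup>2\<^sup>g\<close> are indexed by \<open>'g + 'g\<close> with \<open>g = CARD('g)\<close>, the two summands indexing
  the two halves of a symplectic basis.\<close>

definition symp_form :: "'a::comm_ring_1 ^ ('g::finite + 'g) \<Rightarrow> 'a ^ ('g + 'g) \<Rightarrow> 'a" where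
  "symp_form v w = (\<Sum>i\<in>UNIV. v $ Inl i * w $ Inr i - v $ Inr i * w $ Inl i)"

definition is_multiplier :: "'a::comm_ring_1 ^ ('g::finite + 'g) ^ ('g + 'g) \<Rightarrow> 'a \<Rightarrow> bool" where
  "is_multiplier S c \<longleftrightarrow> (\<forall>v w. symp_form (S *v v) (S *v w) = c * symp_form v w)"

definition multiplier :: "'a::comm_ring_1 ^ ('g::finite + 'g) ^ ('g + 'g) \<Rightarrow> 'a" where
  "multiplier S = (THE c. is_multiplier S c)"

definition GSp :: "('a::comm_ring_1 ^ ('g::finite + 'g) ^ ('g + 'g)) monoid" where
  "GSp = \<lparr>carrier = {S. invertible S \<and> (\<exists>c. c dvd 1 \<and> is_multiplier S c)},
          mult = (**), one = mat 1\<rparr>"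

definition Sp :: "('a::comm_ring_1 ^ ('g::finite + 'g) ^ ('g + 'g)) monoid" where
  "Sp = \<lparr>carrier = {S. invertible S \<and> is_multiplier S 1}, mult = (**), one = mat 1\<rparr>"


section \<open>The symmetric group inside the symplectic group over \<open>\<F>\<^sub>2\<close>\<close>

text \<open>The coordinates of \<open>V = \<F>\<^sub>2\<^sup>2\<^sup>g\<^sup>+\<^sup>2\<close> are indexed by a type \<open>'m\<close>, to be used with
  \<open>CARD('m) = 2 * CARD('g) + 2\<close>.\<close>

definition dot2 :: "bit ^ 'm::finite \<Rightarrow> bit ^ 'm \<Rightarrow> bit" where
  "dot2 v w = (\<Sum>i\<in>UNIV. v $ i * w $ i)"

definition all_ones :: "bit ^ 'm::finite" where
  "all_ones = (\<chi> i. 1)"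

definition ones_perp :: "(bit ^ 'm::finite) set" where
  "ones_perp = {v. dot2 v all_ones = 0}"

definition ones_class :: "bit ^ 'm::finite \<Rightarrow> (bit ^ 'm) set" where
  "ones_class v = (+) v ` vec.span {all_ones}"

definition W_space :: "(bit ^ 'm::finite) set set" where
  "W_space = ones_class ` ones_perp"

text \<open>A symplectic identification of \<open>W = t\<^sup>\<bottom>/span(t)\<close> with \<open>\<F>\<^sub>2\<^sup>2\<^sup>g\<close>. The vector space structure
  and the form on \<open>W\<close> are the ones induced from representatives.\<close>

definition symp_identification ::
    "((bit ^ 'm::finite) set \<Rightarrow> bit ^ ('g::finite + 'g)) \<Rightarrow> bool" where
  "symp_identification \<iota> \<longleftrightarrow>
     bij_betw \<iota> W_space UNIV \<and>
     (\<forall>v\<in>ones_perp. \<forall>w\<in>ones_perp.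
        \<iota> (ones_class (v + w)) = \<iota> (ones_class v) + \<iota> (ones_class w)) \<and>
     (\<forall>c. \<forall>v\<in>ones_perp. \<iota> (ones_class (c *s v)) = c *s \<iota> (ones_class v)) \<and>
     (\<forall>v\<in>ones_perp. \<forall>w\<in>ones_perp.
        symp_form (\<iota> (ones_class v)) (\<iota> (ones_class w)) = dot2 v w)"

definition permute_coords :: "('m \<Rightarrow> 'm) \<Rightarrow> bit ^ 'm::finite \<Rightarrow> bit ^ 'm" where
  "permute_coords \<sigma> v = (\<chi> i. v $ (inv_into UNIV \<sigma> i))"

definition acts_as_perm ::
    "((bit ^ 'm::finite) set \<Rightarrow> bit ^ ('g::finite + 'g)) \<Rightarrow> bit ^ ('g + 'g) ^ ('g + 'g)
      \<Rightarrow> ('m \<Rightarrow> 'm) \<Rightarrow> bool" where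
  "acts_as_perm \<iota> M \<sigma> \<longleftrightarrow>
     (\<forall>v\<in>ones_perp. M *v \<iota> (ones_class v) = \<iota> (ones_class (permute_coords \<sigma> v)))"

text \<open>The image of \<open>S\<^sub>2\<^sub>g\<^sub>+\<^sub>1\<close>, the stabilizer of the coordinate \<open>l\<close> in \<open>S\<^sub>2\<^sub>g\<^sub>+\<^sub>2\<close>.\<close>

definition sym_stabilizer ::
    "((bit ^ 'm::finite) set \<Rightarrow> bit ^ ('g::finite + 'g)) \<Rightarrow> 'm
      \<Rightarrow> (bit ^ ('g + 'g) ^ ('g + 'g)) set" where
  "sym_stabilizer \<iota> l = {M. \<exists>\<sigma>. \<sigma> permutes UNIV \<and> \<sigma> l = l \<and> acts_as_perm \<iota> M \<sigma>}"


section \<open>Topological abelianization\<close>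

definition quot_topology :: "'a topology \<Rightarrow> ('a \<Rightarrow> 'b) \<Rightarrow> 'b topology" where
  "quot_topology X f =
     topology (\<lambda>U. U \<subseteq> f ` topspace X \<and> openin X {x \<in> topspace X. f x \<in> U})"

lemma openin_quot_topology:
  "openin (quot_topology X f) U \<longleftrightarrow>
     U \<subseteq> f ` topspace X \<and> openin X {x \<in> topspace X. f x \<in> U}"
proof -
  have "istopology (\<lambda>U. U \<subseteq> f ` topspace X \<and> openin X {x \<in> topspace X. f x \<in> U})"
    unfolding istopology_def
  proof (intro conjI allI impI)
    fix S T
    assume S: "S \<subseteq> f ` topspace X \<and> openin X {x \<in> topspace X. f x \<in> S}"
      and T: "T \<subseteq> f ` topspace X \<and> openin X {x \<in> topspace X. f x \<in> T}"
    show "S \<inter> T \<subseteq> f ` topspace X" using S by blast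
    have "{x \<in> topspace X. f x \<in> S \<inter> T} =
        {x \<in> topspace X. f x \<in> S} \<inter> {x \<in> topspace X. f x \<in> T}" by blast
    then show "openin X {x \<in> topspace X. f x \<in> S \<inter> T}" using S T by auto
  next
    fix K
    assume K: "\<forall>S\<in>K. S \<subseteq> f ` topspace X \<and> openin X {x \<in> topspace X. f x \<in> S}"
    show "\<Union> K \<subseteq> f ` topspace X" using K by blast
    have "{x \<in> topspace X. f x \<in> \<Union> K} = (\<Union>S\<in>K. {x \<in> topspace X. f x \<in> S})" by blast
    then show "openin X {x \<in> topspace X. f x \<in> \<Union> K}" using K by auto
  qed
  then show ?thesis
    by (simp add: quot_topology_def)
qed

text \<open>In the following, \<open>X\<close> is the topology of the group \<open>G\<close>, with \<open>topspace X = carrier G\<close>.\<close>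

definition top_derived :: "'a topology \<Rightarrow> ('a, 'b) monoid_scheme \<Rightarrow> 'a set" where
  "top_derived X G = X closure_of (derived G (carrier G))"

definition top_ab :: "'a topology \<Rightarrow> ('a, 'b) monoid_scheme \<Rightarrow> 'a set monoid" where
  "top_ab X G = G Mod top_derived X G"

definition ab_class :: "'a topology \<Rightarrow> ('a, 'b) monoid_scheme \<Rightarrow> 'a \<Rightarrow> 'a set" where
  "ab_class X G x = top_derived X G #>\<^bsub>G\<^esub> x"

definition ab_topology :: "'a topology \<Rightarrow> ('a, 'b) monoid_scheme \<Rightarrow> 'a set topology" where
  "ab_topology X G = quot_topology X (ab_class X G)"

end

theory Submission
  imports Defs "HOL-Number_Theory.Modular_Inverse"
begin

text \<open>That \<open>[H, H]\<close> lies in the preimage is clear, and the converse reduces to \<open>ker \<phi> \<subseteq> [H, H]\<close>. By density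
  this may be checked on each graded piece \<open>\<Gamma>(2\<^sup>n)/\<Gamma>(2\<^sup>n\<^sup>+\<^sup>1) = sp(\<F>\<^sub>2)\<close>, \<open>n \<ge> 1\<close>: the commutator of a lift of
  \<open>T \<in> S\<^sub>2\<^sub>g\<^sub>+\<^sub>1\<close> with \<open>1 + 2\<^sup>n A\<close>, where \<open>A \<in> gsp(\<F>\<^sub>2)\<close>, has class \<open>T A T\<^sup>-\<^sup>1 - A\<close>, and these classes span
  \<open>sp(\<F>\<^sub>2)\<close>. Indeed transpositions act as the transvections along the images \<open>v\<close> of \<open>e\<^sub>i + e\<^sub>j\<close>. Modulo the
  span, all \<open>v \<otimes> v\<close> agree with a single element \<open>a\<close>, hence \<open>v \<otimes> w + w \<otimes> v\<close> agrees with \<open>\<langle>v, w\<rangle> a\<close>; taking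
  for \<open>A\<close> the projection onto a Lagrangian subspace, which has nonzero multiplier, then shows that
  \<open>a\<close> itself lies in the span.

  The map to \<open>H(2)\<^sup>a\<^sup>b \<times> \<int>\<^sub>2\<^sup>\<times>\<close> therefore has kernel \<open>[H, H]\<close>; it is open and onto because of the matrices
  \<open>diag(u, 1)\<close>, which are close to the identity whenever \<open>u\<close> is close to \<open>1\<close>.\<close>

text \<open>These rules would turn ring arithmetic on \<open>bit\<close> into bit operations.\<close>

declare add_bit_eq_xor [simp del] mult_bit_eq_and [simp del]
  minus_bit_def [simp del] uminus_bit_def [simp del]

section \<open>Arithmetic of the 2-adic integers\<close>

lemma residue_at_mod: "m \<le> n \<Longrightarrow> residue_at x n mod 2 ^ m = residue_at x m"
  using residue_at[of x] by simp

lemma residue_at_mod_self [simp]: "residue_at x n mod 2 ^ n = residue_at x n"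
  by (rule residue_at_mod) simp

lemma residue_at_of_nat: "residue_at (of_nat k) n = int k mod 2 ^ n"
proof (induction k)
  case 0
  show ?case by (simp add: zero_z2adic.rep_eq)
next
  case (Suc k)
  then show ?case
    by (simp add: plus_z2adic.rep_eq one_z2adic.rep_eq mod_add_right_eq)
qed

lemma residue_at_two_power: "residue_at (2 ^ k) n = 2 ^ k mod 2 ^ n"
  using residue_at_of_nat[of "2 ^ k" n] by simp

text \<open>The quotient by \<open>2 ^ n\<close> is built by shifting the coherent sequence by
  \<open>n\<close> places. This turns statements about residues, and hence about the topology, into
  divisibility statements.\<close>

lemma residue_at_eq_0_iff: "residue_at z n = 0 \<longleftrightarrow> 2 ^ n dvd z"
proof
  assume "2 ^ n dvd z"
  then obtain w where "z = 2 ^ n * w" by (elim dvdE)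
  then show "residue_at z n = 0"
    by (simp add: times_z2adic.rep_eq residue_at_two_power)
next
  assume z: "residue_at z n = 0"
  \<comment> \<open>Division by \<open>2 ^ n\<close> costs \<open>n\<close> digits of precision, so
    the digits below \<open>2 ^ m\<close> are read off at level \<open>m + n\<close>.\<close>
  define f where "f m = residue_at z (m + n) div 2 ^ n" for m
  have f: "residue_at z (m + n) = 2 ^ n * f m" for m
    using residue_at_mod[of n "m + n" z] z by (simp add: f_def mod_eq_0_iff_dvd)
  have "f k mod 2 ^ m = f m" if "m \<le> k" for m k
  proof -
    have "2 ^ n * (f k mod 2 ^ m) = residue_at z (k + n) mod 2 ^ (m + n)"
      by (simp only: f power_add mult_mod_right mult.commute[of "2 ^ m"])
    also have "\<dots> = 2 ^ n * f m"
      using residue_at_mod[of "m + n" "k + n" z] f[of m] that by simp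
    finally show ?thesis by simp
  qed
  then have rep: "residue_at (Abs_z2adic f) = f"
    by (intro Abs_z2adic_inverse) simp
  have "residue_at z m = residue_at (2 ^ n * Abs_z2adic f) m" for m
  proof -
    have "residue_at (2 ^ n * Abs_z2adic f) m = 2 ^ n * f m mod 2 ^ m"
      by (simp add: times_z2adic.rep_eq residue_at_two_power rep mod_mult_left_eq)
    also have "\<dots> = residue_at z m"
      using f[of m] residue_at_mod[of m "m + n" z] by simp
    finally show ?thesis by simp
  qed
  then have "z = 2 ^ n * Abs_z2adic f"
    by (simp add: residue_at_inject[symmetric] fun_eq_iff)
  then show "2 ^ n dvd z" by simp
qed

lemma residue_at_eq_iff: "residue_at x n = residue_at y n \<longleftrightarrow> 2 ^ n dvd x - y"
proof -
  have "2 ^ n dvd x - y \<longleftrightarrow> (residue_at x n - residue_at y n) mod 2 ^ n = 0"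
    by (simp add: residue_at_eq_0_iff[symmetric] minus_z2adic.rep_eq)
  also have "\<dots> \<longleftrightarrow> residue_at x n mod 2 ^ n = residue_at y n mod 2 ^ n"
    by (simp only: mod_eq_dvd_iff mod_eq_0_iff_dvd)
  finally show ?thesis by simp
qed

lemma z2adic_eqI: "(\<And>n. 2 ^ n dvd x - y) \<Longrightarrow> x = (y :: z2adic)"
  by (simp add: residue_at_inject[symmetric] fun_eq_iff residue_at_eq_iff)

text \<open>There is no 2-torsion: if \<open>2 ^ n\<close> times a number vanishes at level
  \<open>m + n\<close>, the number vanishes at level \<open>m\<close>.\<close>

lemma two_power_mult_left_cancel [simp]: "2 ^ n * x = 2 ^ n * y \<longleftrightarrow> x = (y :: z2adic)"
proof
  assume *: "2 ^ n * x = 2 ^ n * y"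
  have "residue_at (x - y) m = 0" for m
  proof -
    have "2 ^ n * (x - y) = 0" using * by (simp add: right_diff_distrib)
    then have "(2 ^ n * residue_at (x - y) (m + n)) mod 2 ^ (m + n) = 0"
      by (metis mod_mult_left_eq residue_at_two_power times_z2adic.rep_eq zero_z2adic.rep_eq)
    then have "residue_at (x - y) (m + n) mod 2 ^ m = 0"
      by (simp add: power_add mult.commute[of "2 ^ m"] mult_mod_right[symmetric])
    then show ?thesis by (simp add: residue_at_mod)
  qed
  then show "x = y"
    by (intro z2adic_eqI) (simp add: residue_at_eq_0_iff)
qed simp

text \<open>An odd residue is invertible modulo every \<open>2 ^ n\<close>. Reduced inverses are
  unique, so those at different levels are coherent and define a 2-adic inverse.\<close>

lemma two_dvd_imp_one_plus_unit:
  fixes y :: z2adic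
  assumes "2 dvd y"
  shows "1 + y dvd 1"
proof -
  define u where "u = 1 + y"
  have odd: "coprime (residue_at u n) (2 ^ n)" for n
  proof (cases "n = 0")
    case False
    have "2 ^ 1 dvd u - 1" using assms by (simp add: u_def)
    then have "residue_at u 1 = 1"
      by (simp only: residue_at_eq_iff[symmetric]) (simp add: one_z2adic.rep_eq)
    then have "residue_at u n mod 2 = 1"
      using residue_at_mod[of 1 n u] False by simp
    then show ?thesis by (simp add: odd_iff_mod_2_eq_one)
  qed simp
  define f where "f n = modular_inverse (2 ^ n) (residue_at u n)" for n
  have inv: "[residue_at u n * f n = 1] (mod 2 ^ n)" for n
    using cong_modular_inverse1[OF odd[of n]] by (simp add: f_def)
  have "f k mod 2 ^ m = f m" if "m \<le> k" for m k
  proof -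
    have "[residue_at u k * f k = 1] (mod 2 ^ m)"
      using inv[of k] that by (metis cong_dvd_modulus le_imp_power_dvd)
    moreover have "[residue_at u m = residue_at u k] (mod 2 ^ m)"
      using residue_at_mod[OF that, of u] by (simp add: cong_def)
    ultimately have "[residue_at u m * f k = residue_at u m * f m] (mod 2 ^ m)"
      using inv[of m] by (meson cong_scalar_right cong_sym cong_trans)
    then have "[f k = f m] (mod 2 ^ m)"
      using odd[of m] by (simp add: cong_mult_lcancel)
    moreover have "0 \<le> f m" "f m < 2 ^ m"
      by (simp_all add: f_def modular_inverse_int_nonneg modular_inverse_int_less)
    ultimately show ?thesis by (simp add: cong_def)
  qed
  then have rep: "residue_at (Abs_z2adic f) = f"
    by (intro Abs_z2adic_inverse) simp
  have "u * Abs_z2adic f = 1"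
    using inv
    by (simp add: residue_at_inject[symmetric] fun_eq_iff times_z2adic.rep_eq rep
        one_z2adic.rep_eq cong_def)
  then show ?thesis unfolding u_def by (metis dvdI)
qed

section \<open>Reduction of 2-adic integers modulo two\<close>

lemma red2_0 [simp]: "red2 0 = 0"
  and red2_1 [simp]: "red2 1 = 1"
  by (simp_all add: red2_def zero_z2adic.rep_eq one_z2adic.rep_eq)

lemma of_int_bit_mod_2 [simp]: "(of_int (k mod 2) :: bit) = of_int k"
proof -
  have "(of_int k :: bit) = of_int (2 * (k div 2) + k mod 2)" by simp
  also have "\<dots> = of_int (k mod 2)" by (simp only: of_int_add of_int_mult) simp
  finally show ?thesis by simp
qed

lemma red2_add [simp]: "red2 (x + y) = red2 x + red2 y"
  and red2_mult [simp]: "red2 (x * y) = red2 x * red2 y"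
  by (simp_all add: red2_def plus_z2adic.rep_eq times_z2adic.rep_eq)

lemma red2_minus [simp]: "red2 (- x) = - red2 x"
  by (rule add_left_imp_eq[of "red2 x"]) (simp flip: red2_add)

lemma red2_diff [simp]: "red2 (x - y) = red2 x - red2 y"
  using red2_add[of x "- y"] by simp

lemma red2_sum [simp]: "red2 (sum f A) = (\<Sum>i\<in>A. red2 (f i))"
  by (induction A rule: infinite_finite_induct) simp_all

lemma red2_two_power [simp]: "n \<ge> 1 \<Longrightarrow> red2 (2 ^ n) = 0"
  by (simp add: red2_def residue_at_two_power)

lemma red2_eq_0_iff: "red2 x = 0 \<longleftrightarrow> 2 dvd x"
proof
  assume "red2 x = 0"
  then have "even (residue_at x 1)"
    using of_int_bit_mod_2[of "residue_at x 1"]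
    by (cases "even (residue_at x 1)") (simp_all add: red2_def odd_iff_mod_2_eq_one del: of_int_bit_mod_2)
  then show "2 dvd x"
    using residue_at_mod_self[of x 1] residue_at_eq_0_iff[of x 1] by simp
next
  assume "2 dvd x"
  then show "red2 x = 0" by (auto elim!: dvdE simp: red2_two_power[of 1, simplified])
qed

lemma red2_surj: "\<exists>x. red2 x = b"
  by (cases b) (auto intro: red2_0 red2_1)

section \<open>Symplectic similitudes over a commutative ring\<close>

lemma symp_form_add_left: "symp_form (u + v) w = symp_form u w + symp_form v w"
  and symp_form_add_right: "symp_form w (u + v) = symp_form w u + symp_form w v"
  by (simp_all add: symp_form_def algebra_simps flip: sum.distrib)

lemma symp_form_smult_left: "symp_form (c *s v) w = c * symp_form v w"
  and symp_form_smult_right: "symp_form v (c *s w) = c * symp_form v w"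
  by (simp_all add: symp_form_def algebra_simps sum_distrib_left)

lemma symp_form_self [simp]: "symp_form v v = 0"
  by (simp add: symp_form_def algebra_simps)

lemma symp_form_skew: "symp_form w v = - symp_form v w"
  by (simp add: symp_form_def algebra_simps flip: sum_negf)

lemma symp_form_zero_left [simp]: "symp_form 0 w = 0"
  and symp_form_zero_right [simp]: "symp_form w 0 = 0"
  by (simp_all add: symp_form_def)

lemma symp_form_sum_right: "symp_form w (\<Sum>i\<in>A. f i) = (\<Sum>i\<in>A. symp_form w (f i))"
  by (induction A rule: infinite_finite_induct) (simp_all add: symp_form_add_right)

lemmas symp_form_linear =
  symp_form_add_left symp_form_add_right symp_form_smult_left symp_form_smult_right

text \<open>Index of the symplectic partner of a basis vector.\<close>

fun sum_swap :: "'a + 'a \<Rightarrow> 'a + 'a" where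
  "sum_swap (Inl i) = Inr i"
| "sum_swap (Inr i) = Inl i"

lemma sum_swap_swap [simp]: "sum_swap (sum_swap i) = i"
  by (cases i) simp_all

lemma symp_form_axis_Inl [simp]: "symp_form v (axis (Inl i) 1) = - v $ Inr i"
  and symp_form_axis_Inr [simp]: "symp_form v (axis (Inr i) 1) = v $ Inl i"
  by (simp_all add: symp_form_def axis_def if_distrib[of "(*) _"] if_distrib[of "\<lambda>x. _ - x"]
      if_distrib[of uminus] sum.delta cong: if_cong)

lemma vec_eq_sum_axis: "v = (\<Sum>i\<in>UNIV. v $ i *s axis i (1 :: 'a :: comm_ring_1))"
  by (simp add: vec_eq_iff axis_def if_distrib sum.delta' cong: if_cong)

text \<open>The form identifies the module with its dual, hence endomorphisms with tensors; this is
  the pure tensor \<open>v \<otimes> w\<close>. Symmetric tensors then correspond to elements of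
  \<open>sp\<close>.\<close>

definition tens :: "'a::comm_ring_1 ^ ('g::finite + 'g) \<Rightarrow> 'a ^ ('g + 'g) \<Rightarrow> 'a ^ ('g + 'g) ^ ('g + 'g)"
  where "tens v w = (\<chi> i j. v $ i * symp_form w (axis j 1))"

lemma tens_mult_vec [simp]: "tens v w *v x = symp_form w x *s v"
proof -
  have "symp_form w x = (\<Sum>j\<in>UNIV. x $ j * symp_form w (axis j 1))"
    by (subst vec_eq_sum_axis[of x]) (simp add: symp_form_sum_right symp_form_linear)
  then show ?thesis
    by (simp add: vec_eq_iff tens_def matrix_vector_mult_def sum_distrib_left mult_ac)
qed

lemma tens_add_left: "tens (u + v) w = tens u w + tens v w"
  and tens_add_right: "tens w (u + v) = tens w u + tens w v"
  by (simp_all add: tens_def vec_eq_iff symp_form_linear algebra_simps)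

section \<open>Multipliers and the group of similitudes\<close>

lemma is_multiplier_mult:
  "is_multiplier S c \<Longrightarrow> is_multiplier S' c' \<Longrightarrow> is_multiplier (S ** S') (c * c')"
  by (simp add: is_multiplier_def mult.assoc flip: matrix_vector_mul_assoc)

lemma is_multiplier_one [simp]: "is_multiplier (mat 1) 1"
  by (simp add: is_multiplier_def)

lemma is_multiplier_inverse:
  assumes "S ** S' = mat 1" "is_multiplier S c" "c * d = 1"
  shows "is_multiplier S' d"
  unfolding is_multiplier_def
proof (intro allI)
  fix v w
  have "symp_form v w = c * symp_form (S' *v v) (S' *v w)"
    using assms(1,2) unfolding is_multiplier_def
    by (metis matrix_vector_mul_assoc matrix_vector_mul_lid)
  then have "d * symp_form v w = (c * d) * symp_form (S' *v v) (S' *v w)"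
    by (simp add: mult_ac)
  then show "symp_form (S' *v v) (S' *v w) = d * symp_form v w"
    using assms(3) by simp
qed

text \<open>Basis vectors of a hyperbolic pair have pairing one. Evaluating there makes the
  multiplier unique and exhibits it as a polynomial in the matrix entries.\<close>

lemma is_multiplier_imp_eq:
  fixes S :: "'a::comm_ring_1 ^ ('g::finite + 'g) ^ ('g + 'g)"
  assumes "is_multiplier S c"
  shows "c = symp_form (S *v axis (Inl i) 1) (S *v axis (Inr i) 1)"
proof -
  have "symp_form (axis (Inl i) 1) (axis (Inr i) 1) = (1 :: 'a)"
    unfolding symp_form_axis_Inr by (simp add: axis_def)
  then show ?thesis using assms by (simp add: is_multiplier_def del: symp_form_axis_Inr)
qed

lemma multiplier_eqI: "is_multiplier S c \<Longrightarrow> multiplier S = c"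
  unfolding multiplier_def using is_multiplier_imp_eq by (metis the_equality)

lemma carrier_GSp_iff:
  "S \<in> carrier GSp \<longleftrightarrow> invertible S \<and> (\<exists>c. c dvd 1 \<and> is_multiplier S c)"
  by (simp add: GSp_def)

lemma mult_GSp [simp]: "x \<otimes>\<^bsub>GSp\<^esub> y = x ** y"
  and one_GSp [simp]: "\<one>\<^bsub>GSp\<^esub> = mat 1"
  by (simp_all add: GSp_def)

lemma carrier_GSp_multiplier:
  assumes "S \<in> carrier GSp"
  shows "is_multiplier S (multiplier S)" "multiplier S dvd 1"
  using assms multiplier_eqI[of S] by (auto simp: carrier_GSp_iff)

lemma carrier_Sp_iff: "S \<in> carrier Sp \<longleftrightarrow> S \<in> carrier GSp \<and> multiplier S = 1"
proof
  assume "S \<in> carrier Sp"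
  then show "S \<in> carrier GSp \<and> multiplier S = 1"
    using multiplier_eqI[of S 1] by (auto simp: Sp_def carrier_GSp_iff intro!: exI[of _ 1])
next
  assume "S \<in> carrier GSp \<and> multiplier S = 1"
  then show "S \<in> carrier Sp"
    using carrier_GSp_multiplier(1)[of S] by (auto simp: Sp_def carrier_GSp_iff)
qed

lemma carrier_GSpI:
  "S ** S' = mat 1 \<Longrightarrow> S' ** S = mat 1 \<Longrightarrow> is_multiplier S c \<Longrightarrow> c dvd 1 \<Longrightarrow> S \<in> carrier GSp"
  by (auto simp: carrier_GSp_iff invertible_def)

lemma group_GSp: "group (GSp :: ('a::comm_ring_1 ^ ('g::finite + 'g) ^ ('g + 'g)) monoid)"
proof (rule groupI)
  fix x y z :: "'a ^ ('g + 'g) ^ ('g + 'g)"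
  assume x: "x \<in> carrier GSp"
  obtain c x' where c: "c dvd 1" "is_multiplier x c" and x': "x ** x' = mat 1" "x' ** x = mat 1"
    using x by (auto simp: carrier_GSp_iff invertible_def)
  show "x \<otimes>\<^bsub>GSp\<^esub> y \<in> carrier GSp" if "y \<in> carrier GSp"
  proof -
    obtain d y' where d: "d dvd 1" "is_multiplier y d" and y': "y ** y' = mat 1" "y' ** y = mat 1"
      using \<open>y \<in> carrier GSp\<close> by (auto simp: carrier_GSp_iff invertible_def)
    show ?thesis
      unfolding mult_GSp
    proof (rule carrier_GSpI)
      show "x ** y ** (y' ** x') = mat 1" "y' ** x' ** (x ** y) = mat 1"
        using x' y' by (metis matrix_mul_assoc matrix_mul_rid)+
      show "is_multiplier (x ** y) (c * d)"
        using c d by (rule_tac is_multiplier_mult)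
      show "c * d dvd 1"
        using mult_dvd_mono[OF c(1) d(1)] by simp
    qed
  qed
  show "\<exists>y\<in>carrier GSp. y \<otimes>\<^bsub>GSp\<^esub> x = \<one>\<^bsub>GSp\<^esub>"
  proof -
    obtain d where d: "c * d = 1" using c(1) by (metis dvdE)
    have "x' \<in> carrier GSp"
      using is_multiplier_inverse[OF x'(1) c(2) d] x' d
      by (intro carrier_GSpI[of x' x d] dvdI[of 1 d c]) (simp_all add: mult.commute)
    then show ?thesis using x' by auto
  qed
  show "x \<otimes>\<^bsub>GSp\<^esub> y \<otimes>\<^bsub>GSp\<^esub> z = x \<otimes>\<^bsub>GSp\<^esub> (y \<otimes>\<^bsub>GSp\<^esub> z)"
    by (simp add: matrix_mul_assoc)
  show "\<one>\<^bsub>GSp\<^esub> \<otimes>\<^bsub>GSp\<^esub> x = x" by simp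
next
  show "\<one>\<^bsub>GSp\<^esub> \<in> carrier GSp"
    by (simp add: carrier_GSpI[of _ "mat 1" 1])
qed

lemma inverse_GSp:
  assumes "x \<in> carrier GSp"
  shows "x ** inv\<^bsub>GSp\<^esub> x = mat 1" "inv\<^bsub>GSp\<^esub> x ** x = mat 1"
  using group.r_inv[OF group_GSp assms] group.l_inv[OF group_GSp assms] by simp_all

lemma multiplier_mult:
  "x \<in> carrier GSp \<Longrightarrow> y \<in> carrier GSp \<Longrightarrow> multiplier (x ** y) = multiplier x * multiplier y"
  by (intro multiplier_eqI is_multiplier_mult carrier_GSp_multiplier)

text \<open>The parameter serves two purposes: over the field with two elements,
  \<open>c = 1\<close> gives the transvections by which transpositions act; over the 2-adic
  integers, \<open>c = 2 ^ n\<close> gives an element of the \<open>n\<close>-th congruence subgroup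
  with class \<open>tens v v\<close>.\<close>

definition transv :: "'a::comm_ring_1 \<Rightarrow> 'a ^ ('g::finite + 'g) \<Rightarrow> 'a ^ ('g + 'g) ^ ('g + 'g)"
  where "transv c v = mat 1 + map_matrix ((*) c) (tens v v)"

lemma map_matrix_times_mult_vec: "map_matrix ((*) c) A *v x = c *s (A *v (x :: 'a::comm_ring_1 ^ _))"
  by (simp add: vec_eq_iff map_matrix_def matrix_vector_mult_def sum_distrib_left mult_ac)

lemma transv_mult_vec: "transv c v *v x = x + (c * symp_form v x) *s v"
  by (simp add: transv_def matrix_vector_mult_add_rdistrib map_matrix_times_mult_vec vector_smult_assoc)

lemma is_multiplier_transv: "is_multiplier (transv c v) 1"
  unfolding is_multiplier_def
proof (intro allI)
  fix x y
  have "symp_form x v = - symp_form v x" by (rule symp_form_skew)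
  then show "symp_form (transv c v *v x) (transv c v *v y) = 1 * symp_form x y"
    by (simp add: transv_mult_vec symp_form_linear algebra_simps)
qed

lemma transv_inverse: "transv c v ** transv (- c) v = mat 1"
  by (simp add: matrix_eq transv_mult_vec symp_form_linear vec_eq_iff algebra_simps
      flip: matrix_vector_mul_assoc)

lemma transv_in_GSp: "transv c v \<in> carrier GSp"
  using transv_inverse[of c v] transv_inverse[of "- c" v] is_multiplier_transv[of c v]
  by (intro carrier_GSpI[of _ "transv (- c) v" 1]) simp_all

text \<open>A section of the multiplier on units. Non-units are allowed too:
  \<open>mat 1 - torus 0\<close> is the projection onto the first Lagrangian half.\<close>

definition torus :: "'a::comm_ring_1 \<Rightarrow> 'a ^ ('g::finite + 'g) ^ ('g + 'g)"
  where "torus u = (\<chi> i j. if i = j then case i of Inl _ \<Rightarrow> u | Inr _ \<Rightarrow> 1 else 0)"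

lemma torus_mult_vec_nth:
  "(torus u *v x) $ Inl i = u * x $ Inl i"
  "(torus u *v x) $ Inr i = x $ Inr i"
  by (simp_all add: torus_def matrix_vector_mult_def if_distrib[of "\<lambda>x. x * _"] sum.delta
      cong: if_cong)

lemma is_multiplier_torus: "is_multiplier (torus u) u"
  by (simp add: is_multiplier_def symp_form_def torus_mult_vec_nth sum_distrib_left algebra_simps)

lemma torus_mult: "torus u ** torus v = torus (u * v)"
  unfolding matrix_eq vec_eq_iff matrix_vector_mul_assoc[symmetric]
proof (intro allI)
  fix x i show "(torus u *v (torus v *v x)) $ i = (torus (u * v) *v x) $ i"
    by (cases i) (simp_all add: torus_mult_vec_nth mult_ac)
qed

lemma torus_one [simp]: "torus 1 = mat 1"
  by (auto simp: torus_def mat_def vec_eq_iff split: sum.split)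

lemma torus_in_GSp:
  assumes "u dvd 1" shows "torus u \<in> carrier GSp"
proof -
  obtain v where "u * v = 1" using assms by (metis dvdE)
  then show ?thesis
    using assms by (intro carrier_GSpI[of _ "torus v" u])
      (simp_all add: torus_mult is_multiplier_torus mult.commute)
qed

section \<open>Reduction and congruence of matrices\<close>

lemma map_matrix_nth [simp]: "map_matrix f A $ i $ j = f (A $ i $ j)"
  by (simp add: map_matrix_def)

lemma red2_mat_add [simp]: "red2_mat (A + B) = red2_mat A + red2_mat B"
  by (simp add: vec_eq_iff)

lemma red2_mat_mult [simp]: "red2_mat (A ** B) = red2_mat A ** red2_mat B"
  by (simp add: vec_eq_iff matrix_matrix_mult_def)

lemma red2_mat_one [simp]: "red2_mat (mat 1) = mat 1"
  by (simp add: vec_eq_iff mat_def)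

definition red2_vec :: "z2adic ^ 'n::finite \<Rightarrow> bit ^ 'n"
  where "red2_vec v = (\<chi> i. red2 (v $ i))"

lemma red2_vec_mult [simp]: "red2_vec (A *v x) = red2_mat A *v red2_vec x"
  by (simp add: vec_eq_iff matrix_vector_mult_def red2_vec_def)

lemma red2_symp_form [simp]: "red2 (symp_form v w) = symp_form (red2_vec v) (red2_vec w)"
  by (simp add: symp_form_def red2_vec_def)

lemma red2_vec_surj: obtains x where "red2_vec x = v"
proof
  show "red2_vec (\<chi> i. SOME x. red2 x = v $ i) = v"
    using someI_ex[OF red2_surj] by (simp add: red2_vec_def vec_eq_iff)
qed

lemma is_multiplier_red2:
  fixes S :: "z2adic ^ ('g::finite + 'g) ^ ('g + 'g)"
  assumes "is_multiplier S c"
  shows "is_multiplier (red2_mat S) (red2 c)"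
  unfolding is_multiplier_def
proof (intro allI)
  fix v w :: "bit ^ ('g + 'g)"
  obtain x where x: "red2_vec x = v" by (rule red2_vec_surj)
  obtain y where y: "red2_vec y = w" by (rule red2_vec_surj)
  have "red2 (symp_form (S *v x) (S *v y)) = red2 (c * symp_form x y)"
    using assms by (simp only: is_multiplier_def)
  then show "symp_form (red2_mat S *v v) (red2_mat S *v w) = red2 c * symp_form v w"
    by (simp add: x y)
qed

lemma red2_mat_in_GSp:
  assumes "S \<in> carrier GSp"
  shows "red2_mat S \<in> carrier GSp"
proof -
  obtain c S' where S: "c dvd 1" "is_multiplier S c" "S ** S' = mat 1" "S' ** S = mat 1"
    using assms by (auto simp: carrier_GSp_iff invertible_def)
  show ?thesis
  proof (rule carrier_GSpI)
    show "is_multiplier (red2_mat S) (red2 c)" using S(2) by (rule is_multiplier_red2)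
    show "red2_mat S ** red2_mat S' = mat 1" "red2_mat S' ** red2_mat S = mat 1"
      using S(3,4) by (metis red2_mat_mult red2_mat_one)+
    obtain d where "1 = c * d" using S(1) by (elim dvdE)
    then have "red2 1 = red2 (c * d)" by simp
    then have "1 = red2 c * red2 d" by simp
    then show "red2 c dvd 1" by (rule dvdI)
  qed
qed

lemma red2_mat_group_hom:
  "group_hom GSp GSp (red2_mat :: z2adic ^ ('g::finite + 'g) ^ ('g + 'g) \<Rightarrow> _)"
  unfolding group_hom_def group_hom_axioms_def
  by (auto simp: group_GSp hom_def red2_mat_in_GSp)

section \<open>Congruence modulo powers of two and the 2-adic topology on matrices\<close>

definition mat_cong :: "nat \<Rightarrow> z2adic ^ 'n::finite ^ 'm::finite \<Rightarrow> z2adic ^ 'n ^ 'm \<Rightarrow> bool"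
  where "mat_cong n X Y \<longleftrightarrow> (\<forall>i j. 2 ^ n dvd X $ i $ j - Y $ i $ j)"

lemma mat_cong_refl [simp]: "mat_cong n X X"
  by (simp add: mat_cong_def)

lemma mat_cong_sym: "mat_cong n X Y \<Longrightarrow> mat_cong n Y X"
  unfolding mat_cong_def by (metis dvd_minus_iff minus_diff_eq)

lemma mat_cong_trans: "mat_cong n X Y \<Longrightarrow> mat_cong n Y Z \<Longrightarrow> mat_cong n X Z"
  unfolding mat_cong_def
proof (intro allI)
  fix i j
  assume "\<forall>i j. 2 ^ n dvd X $ i $ j - Y $ i $ j" "\<forall>i j. 2 ^ n dvd Y $ i $ j - Z $ i $ j"
  then have "2 ^ n dvd (X $ i $ j - Y $ i $ j) + (Y $ i $ j - Z $ i $ j)"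
    by (intro dvd_add) auto
  then show "2 ^ n dvd X $ i $ j - Z $ i $ j" by simp
qed

lemma mat_cong_mono: "mat_cong n X Y \<Longrightarrow> m \<le> n \<Longrightarrow> mat_cong m X Y"
  unfolding mat_cong_def by (meson dvd_trans le_imp_power_dvd)

lemma mat_cong_mult:
  assumes "mat_cong n X X'" "mat_cong n Y Y'"
  shows "mat_cong n (X ** Y) (X' ** Y')"
proof -
  have "2 ^ n dvd X $ i $ k * Y $ k $ j - X' $ i $ k * Y' $ k $ j" for i j k
  proof -
    have "X $ i $ k * Y $ k $ j - X' $ i $ k * Y' $ k $ j =
        (X $ i $ k - X' $ i $ k) * Y $ k $ j + X' $ i $ k * (Y $ k $ j - Y' $ k $ j)"
      by (simp add: algebra_simps)
    then show ?thesis using assms by (simp add: mat_cong_def)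
  qed
  then show ?thesis
    by (auto simp: mat_cong_def matrix_matrix_mult_def sum_subtractf[symmetric] intro!: dvd_sum)
qed

lemma mat_cong_imp_red2_eq: "mat_cong n X Y \<Longrightarrow> n \<ge> 1 \<Longrightarrow> red2_mat X = red2_mat Y"
proof -
  assume "mat_cong n X Y" "n \<ge> 1"
  then have "mat_cong 1 X Y" by (rule mat_cong_mono)
  then have "red2 (X $ i $ j - Y $ i $ j) = 0" for i j
    by (simp add: mat_cong_def red2_eq_0_iff del: red2_diff)
  then show ?thesis by (simp add: vec_eq_iff)
qed

lemma matrix_vector_mult_axis: "(A *v axis j 1) $ i = (A :: 'a::comm_ring_1 ^ 'n ^ 'm) $ i $ j"
  by (simp add: matrix_vector_mult_def axis_def if_distrib[of "(*) _"] cong: if_cong)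

text \<open>The multiplier is a sum of two by two minors, hence an integral polynomial in the
  entries, and so respects congruences. This is its 2-adic continuity.\<close>

lemma multiplier_cong:
  fixes X Y :: "z2adic ^ ('g::finite + 'g) ^ ('g + 'g)"
  assumes "X \<in> carrier GSp" "Y \<in> carrier GSp" "mat_cong n X Y"
  shows "2 ^ n dvd multiplier X - multiplier Y"
proof -
  \<comment> \<open>Any index will do: the multiplier can be read off from any hyperbolic
    pair.\<close>
  define k :: 'g where "k = undefined"
  define P where "P S i = S $ Inl i $ Inl k * S $ Inr i $ Inr k - S $ Inr i $ Inl k * S $ Inl i $ Inr k"
    for S :: "z2adic ^ ('g + 'g) ^ ('g + 'g)" and i
  have P: "multiplier S = (\<Sum>i\<in>UNIV. P S i)" if "S \<in> carrier GSp" for S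
    using is_multiplier_imp_eq[OF carrier_GSp_multiplier(1)[OF that], of k]
    by (simp add: symp_form_def P_def matrix_vector_mult_axis)
  have "2 ^ n dvd P X i - P Y i" for i
  proof -
    have "P X i - P Y i =
        (X $ Inl i $ Inl k - Y $ Inl i $ Inl k) * X $ Inr i $ Inr k
        + Y $ Inl i $ Inl k * (X $ Inr i $ Inr k - Y $ Inr i $ Inr k)
        - ((X $ Inr i $ Inl k - Y $ Inr i $ Inl k) * X $ Inl i $ Inr k
        + Y $ Inr i $ Inl k * (X $ Inl i $ Inr k - Y $ Inl i $ Inr k))"
      by (simp add: P_def algebra_simps)
    then show ?thesis using assms(3) by (simp add: mat_cong_def)
  qed
  then show ?thesis
    using assms(1,2) by (auto simp: P sum_subtractf[symmetric] intro!: dvd_sum)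
qed

text \<open>The topology is an iterated product over finite index sets, so only finitely many
  precisions occur and their maximum serves all entries.\<close>

lemma open_mat_iff:
  fixes U :: "(z2adic ^ 'n::finite ^ 'm::finite) set"
  shows "open U \<longleftrightarrow> (\<forall>X\<in>U. \<exists>n. \<forall>Y. mat_cong n Y X \<longrightarrow> Y \<in> U)"
proof
  assume U: "open U"
  show "\<forall>X\<in>U. \<exists>n. \<forall>Y. mat_cong n Y X \<longrightarrow> Y \<in> U"
  proof
    fix X assume "X \<in> U"
    then obtain A where A: "\<And>i. open (A i)" "\<And>i. X $ i \<in> A i" "\<And>Y. (\<forall>i. Y $ i \<in> A i) \<Longrightarrow> Y \<in> U"
      using U unfolding open_vec_def by metis
    have "\<exists>B. \<forall>j. open (B j) \<and> X $ i $ j \<in> B j \<and> (\<forall>y. (\<forall>j. y $ j \<in> B j) \<longrightarrow> y \<in> A i)" for i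
      using A(1)[of i] A(2)[of i] unfolding open_vec_def by metis
    then obtain B where B: "\<And>i j. open (B i j)" "\<And>i j. X $ i $ j \<in> B i j"
      "\<And>i y. (\<forall>j. y $ j \<in> B i j) \<Longrightarrow> y \<in> A i"
      by metis
    have "\<exists>n. \<forall>y. residue_at y n = residue_at (X $ i $ j) n \<longrightarrow> y \<in> B i j" for i j
      using B(1,2)[of i j] unfolding open_z2adic_def by blast
    then obtain N where N: "\<And>i j y. residue_at y (N i j) = residue_at (X $ i $ j) (N i j) \<Longrightarrow> y \<in> B i j"
      by metis
    define n where "n = Max (range (\<lambda>(i, j). N i j))"
    have le: "N i j \<le> n" for i j
      unfolding n_def by (rule Max_ge) (auto intro: rev_image_eqI[of "(i, j)"])
    have "Y \<in> U" if "mat_cong n Y X" for Y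
    proof (intro A(3) B(3) N allI)
      fix i j
      show "residue_at (Y $ i $ j) (N i j) = residue_at (X $ i $ j) (N i j)"
        using mat_cong_mono[OF that le[of i j]] by (simp add: mat_cong_def residue_at_eq_iff)
    qed
    then show "\<exists>n. \<forall>Y. mat_cong n Y X \<longrightarrow> Y \<in> U" by blast
  qed
next
  assume U: "\<forall>X\<in>U. \<exists>n. \<forall>Y. mat_cong n Y X \<longrightarrow> Y \<in> U"
  have opn: "open {y :: z2adic. residue_at y n = r}" for n r
    by (auto simp: open_z2adic_def)
  show "open U"
    unfolding open_vec_def[of U]
  proof
    fix X assume "X \<in> U"
    then obtain n where n: "\<And>Y. mat_cong n Y X \<Longrightarrow> Y \<in> U" using U by blast
    show "\<exists>A. (\<forall>i. open (A i) \<and> X $ i \<in> A i) \<and> (\<forall>Y. (\<forall>i. Y $ i \<in> A i) \<longrightarrow> Y \<in> U)"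
    proof (intro exI conjI allI impI)
      fix i
      show "open {y. \<forall>j. y $ j \<in> {z. residue_at z n = residue_at (X $ i $ j) n}}"
        by (intro open_vector_box allI opn)
      show "X $ i \<in> {y. \<forall>j. y $ j \<in> {z. residue_at z n = residue_at (X $ i $ j) n}}" by simp
    next
      fix Y assume "\<forall>i. Y $ i \<in> {y. \<forall>j. y $ j \<in> {z. residue_at z n = residue_at (X $ i $ j) n}}"
      then show "Y \<in> U" by (intro n) (simp add: mat_cong_def residue_at_eq_iff)
    qed
  qed
qed

lemma open_mat_cong: "open {Y. mat_cong n Y X}"
  unfolding open_mat_iff
proof (intro ballI exI allI impI)
  fix Y Z assume "Y \<in> {Y. mat_cong n Y X}" "mat_cong n Z Y"
  then show "Z \<in> {Y. mat_cong n Y X}" using mat_cong_trans by simp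
qed

lemma in_closure_of_mat_iff:
  fixes H A :: "(z2adic ^ 'n::finite ^ 'm::finite) set"
  assumes "A \<subseteq> H"
  shows "X \<in> top_of_set H closure_of A \<longleftrightarrow> X \<in> H \<and> (\<forall>n. \<exists>Y\<in>A. mat_cong n Y X)"
proof -
  have "(\<forall>n. \<exists>Y\<in>A. mat_cong n Y X) \<longleftrightarrow> (\<forall>U. X \<in> U \<and> open U \<longrightarrow> (\<exists>Y\<in>A. Y \<in> U))"
  proof (intro iffI allI impI)
    fix U assume "\<forall>n. \<exists>Y\<in>A. mat_cong n Y X" "X \<in> U \<and> open U"
    then show "\<exists>Y\<in>A. Y \<in> U" unfolding open_mat_iff by blast
  next
    fix n assume *: "\<forall>U. X \<in> U \<and> open U \<longrightarrow> (\<exists>Y\<in>A. Y \<in> U)"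
    then show "\<exists>Y\<in>A. mat_cong n Y X"
      using *[rule_format, of "{Y. mat_cong n Y X}"] open_mat_cong[of n X] by auto
  qed
  then show ?thesis
    using in_closure_of[of X euclidean A]
    by (simp add: closure_of_subtopology Int_absorb1[OF assms] Bex_def)
qed

section \<open>The congruence filtration\<close>

text \<open>The class of \<open>k\<close> in \<open>\<Gamma>(2\<^sup>n)/\<Gamma>(2\<^sup>n\<^sup>+\<^sup>1)\<close> is \<open>A\<close>.\<close>

definition graded_class :: "nat \<Rightarrow> z2adic ^ 'n::finite ^ 'n \<Rightarrow> bit ^ 'n ^ 'n \<Rightarrow> bool"
  where "graded_class n k A \<longleftrightarrow> (\<exists>Z. k = mat 1 + map_matrix ((*) (2 ^ n)) Z \<and> red2_mat Z = A)"

lemma map_matrix_times_mult: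
  fixes A :: "'a::comm_ring_1 ^ 'n::finite ^ 'm::finite" and B :: "'a ^ 'p::finite ^ 'n"
  shows "map_matrix ((*) c) A ** B = map_matrix ((*) c) (A ** B)"
    and "A ** map_matrix ((*) c) B = map_matrix ((*) c) (A ** B)"
  by (simp_all add: vec_eq_iff matrix_matrix_mult_def sum_distrib_left mult_ac)

lemma map_matrix_times_add:
  fixes A B :: "'a::comm_ring_1 ^ 'n::finite ^ 'm::finite"
  shows "map_matrix ((*) c) (A + B) = map_matrix ((*) c) A + map_matrix ((*) c) B"
  by (simp add: vec_eq_iff algebra_simps)

lemma matrix_mult_add_rdistrib:
  "(A + B) ** C = A ** C + B ** (C :: 'a::comm_ring_1 ^ 'n::finite ^ 'm::finite)"
  by (simp add: vec_eq_iff matrix_matrix_mult_def algebra_simps sum.distrib)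

lemma bit_add_self [simp]: "x + x = (0 :: bit)"
  by (cases x) simp_all

lemma bit_mat_add_self [simp]: "A + A = (0 :: bit ^ 'n ^ 'm)"
  by (simp add: vec_eq_iff)

lemma red2_mat_two_power_times [simp]: "n \<ge> 1 \<Longrightarrow> red2_mat (map_matrix ((*) (2 ^ n)) Z) = 0"
  by (simp add: vec_eq_iff)

lemma graded_class_red2: "graded_class n k A \<Longrightarrow> n \<ge> 1 \<Longrightarrow> red2_mat k = mat 1"
  by (auto simp: graded_class_def)

text \<open>The product is \<open>1 + 2 ^ n (Z k' + Z')\<close>, and \<open>k'\<close> is trivial
  modulo two because \<open>n \<ge> 1\<close>. Multiplication thus becomes addition on the graded
  piece.\<close>

lemma graded_class_mult:
  assumes "graded_class n k A" "graded_class n k' A'" "n \<ge> 1"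
  shows "graded_class n (k ** k') (A + A')"
proof -
  obtain Z Z' where Z: "k = mat 1 + map_matrix ((*) (2 ^ n)) Z" "red2_mat Z = A"
    "k' = mat 1 + map_matrix ((*) (2 ^ n)) Z'" "red2_mat Z' = A'"
    using assms(1,2) by (auto simp: graded_class_def)
  have "k ** k' = mat 1 + map_matrix ((*) (2 ^ n)) (Z ** k' + Z')"
    unfolding Z(1) matrix_mult_add_rdistrib map_matrix_times_mult map_matrix_times_add
    by (simp add: Z(3) add_ac)
  moreover have "red2_mat (Z ** k' + Z') = A + A'"
    using graded_class_red2[OF assms(2,3)] Z by simp
  ultimately show ?thesis unfolding graded_class_def by blast
qed

lemma red2_mat_minus [simp]: "red2_mat (- A) = red2_mat A"
  by (simp add: vec_eq_iff uminus_bit_def)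

text \<open>The inverse is \<open>1 - 2 ^ n Z k'\<close>; modulo two the sign disappears and
  \<open>k'\<close> becomes trivial, so the class is unchanged.\<close>

lemma graded_class_inverse:
  assumes "graded_class n k A" "k ** k' = mat 1" "n \<ge> 1"
  shows "graded_class n k' A"
proof -
  obtain Z where Z: "k = mat 1 + map_matrix ((*) (2 ^ n)) Z" "red2_mat Z = A"
    using assms(1) by (auto simp: graded_class_def)
  have "k' + map_matrix ((*) (2 ^ n)) (Z ** k') = mat 1"
    using assms(2) by (simp add: Z(1) matrix_mult_add_rdistrib map_matrix_times_mult)
  then have "k' = mat 1 + map_matrix ((*) (2 ^ n)) (- (Z ** k'))"
    by (simp add: vec_eq_iff) (metis add_diff_cancel_right')
  moreover have "red2_mat k' = mat 1"
    using assms(2) graded_class_red2[OF assms(1,3)] by (metis matrix_mul_lid red2_mat_mult red2_mat_one)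
  then have "red2_mat (- (Z ** k')) = A"
    using Z(2) by simp
  ultimately show ?thesis unfolding graded_class_def by blast
qed

text \<open>Conjugation acts on the graded piece only through the reduction of \<open>h\<close>
  modulo two.\<close>

lemma graded_class_conj:
  assumes "graded_class n k A" "h ** h' = mat 1"
  shows "graded_class n (h ** k ** h') (red2_mat h ** A ** red2_mat h')"
proof -
  obtain Z where Z: "k = mat 1 + map_matrix ((*) (2 ^ n)) Z" "red2_mat Z = A"
    using assms(1) by (auto simp: graded_class_def)
  have "h ** k ** h' = mat 1 + map_matrix ((*) (2 ^ n)) (h ** Z ** h')"
    using assms(2)
    by (simp add: Z(1) matrix_mult_add_rdistrib matrix_add_ldistrib map_matrix_times_mult)
  then show ?thesis using Z(2) by (auto simp: graded_class_def)
qed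

lemma mat_cong_one_iff: "mat_cong n k (mat 1) \<longleftrightarrow> (\<exists>A. graded_class n k A)"
proof
  assume "mat_cong n k (mat 1)"
  then have "\<forall>i j. \<exists>z. k $ i $ j - mat 1 $ i $ j = 2 ^ n * z"
    unfolding mat_cong_def dvd_def .
  then obtain Z where Z: "\<And>i j. k $ i $ j - mat 1 $ i $ j = 2 ^ n * Z i j" by metis
  have "k = mat 1 + map_matrix ((*) (2 ^ n)) (\<chi> i j. Z i j)"
    by (simp add: vec_eq_iff flip: Z)
  then show "\<exists>A. graded_class n k A" unfolding graded_class_def by blast
qed (auto simp: graded_class_def mat_cong_def)

lemma graded_class_zero:
  assumes "graded_class n k 0"
  shows "mat_cong (Suc n) k (mat 1)"
proof -
  obtain Z where Z: "k = mat 1 + map_matrix ((*) (2 ^ n)) Z" "red2_mat Z = 0"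
    using assms(1) by (auto simp: graded_class_def)
  have "2 dvd Z $ i $ j" for i j
    using Z(2) by (simp add: vec_eq_iff red2_eq_0_iff)
  then show ?thesis by (simp add: Z(1) mat_cong_def mult.commute[of 2] mult_dvd_mono)
qed

lemma graded_class_transv:
  fixes v :: "z2adic ^ ('g::finite + 'g)"
  shows "graded_class n (transv (2 ^ n) v) (tens (red2_vec v) (red2_vec v))"
proof -
  have "red2_vec (axis j 1) = axis j 1" for j :: "'g + 'g"
    by (simp add: red2_vec_def axis_def vec_eq_iff)
  then have "red2_mat (tens v v) = tens (red2_vec v) (red2_vec v)" for v :: "z2adic ^ ('g + 'g)"
    by (simp add: tens_def vec_eq_iff) (simp add: red2_vec_def)
  then show ?thesis unfolding graded_class_def transv_def by blast
qed

text \<open>This element has multiplier \<open>1 + 2 ^ n\<close>, so it supplies a class in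
  \<open>gsp\<close> that lies outside \<open>sp\<close>.\<close>

lemma graded_class_torus: "graded_class n (torus (1 + 2 ^ n)) (mat 1 - torus 0)"
  unfolding graded_class_def
proof (intro exI conjI)
  show "torus (1 + 2 ^ n) = mat 1 + map_matrix ((*) (2 ^ n)) (mat 1 - torus 0)"
    by (auto simp: vec_eq_iff torus_def mat_def split: sum.split)
  show "red2_mat (mat 1 - torus 0) = mat 1 - torus 0"
    by (auto simp: vec_eq_iff torus_def mat_def split: sum.split)
qed

text \<open>Expand the invariance of the form under \<open>1 + 2 ^ n Z\<close>, cancel
  \<open>2 ^ n\<close>, and reduce modulo two; the quadratic term still carries a factor
  \<open>2 ^ n\<close> and dies since \<open>n \<ge> 1\<close>.\<close>

lemma graded_class_symplectic:
  assumes "graded_class n k A" "is_multiplier k 1" "n \<ge> 1"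
  shows "symp_form (A *v x) y + symp_form x (A *v y) = 0"
proof -
  obtain Z where Z: "k = mat 1 + map_matrix ((*) (2 ^ n)) Z" "red2_mat Z = A"
    using assms(1) by (auto simp: graded_class_def)
  obtain v where v: "red2_vec v = x" by (rule red2_vec_surj)
  obtain w where w: "red2_vec w = y" by (rule red2_vec_surj)
  have "symp_form v w = symp_form (v + 2 ^ n *s (Z *v v)) (w + 2 ^ n *s (Z *v w))"
    using assms(2)
    by (simp add: is_multiplier_def Z(1) matrix_vector_mult_add_rdistrib map_matrix_times_mult_vec)
  also have "\<dots> = symp_form v w + 2 ^ n * (symp_form (Z *v v) w + symp_form v (Z *v w)
      + 2 ^ n * symp_form (Z *v v) (Z *v w))"
    by (simp add: symp_form_linear algebra_simps)
  finally have "2 ^ n * (symp_form (Z *v v) w + symp_form v (Z *v w)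
      + 2 ^ n * symp_form (Z *v v) (Z *v w)) = 2 ^ n * 0" by simp
  then have "red2 (symp_form (Z *v v) w + symp_form v (Z *v w)
      + 2 ^ n * symp_form (Z *v v) (Z *v w)) = red2 0"
    by (simp only: two_power_mult_left_cancel)
  then show ?thesis using assms(3) by (simp add: v w Z(2))
qed

section \<open>Generating the symplectic Lie algebra over the field with two elements\<close>

lemma bit_mat_add_left_self [simp]: "A + (A + B) = (B :: bit ^ 'n ^ 'm)"
  by (simp flip: add.assoc)

lemma symp_form_bit_commute: "symp_form v w = symp_form w (v :: bit ^ ('g::finite + 'g))"
  using symp_form_skew[of v w] by (simp add: uminus_bit_def)

text \<open>A symplectic map carries \<open>v \<otimes> v\<close> to the tensor square of the image
  of \<open>v\<close>; in characteristic two a transvection is its own inverse.\<close>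

lemma transv_conj_tens:
  fixes v w :: "bit ^ ('g::finite + 'g)"
  shows "transv 1 w ** tens v v ** transv 1 w = tens (transv 1 w *v v) (transv 1 w *v v)"
  by (simp add: matrix_eq transv_mult_vec symp_form_linear symp_form_bit_commute[of v w]
      vec_eq_iff algebra_simps flip: matrix_vector_mul_assoc)

lemma transv_bit_involution: "transv 1 w ** transv 1 w = (mat 1 :: bit ^ ('g::finite + 'g) ^ _)"
  using transv_inverse[of 1 w] by (simp add: uminus_bit_def)

text \<open>The projection onto one of two complementary Lagrangian halves is an infinitesimal
  similitude with multiplier one.\<close>

lemma symp_form_proj:
  "symp_form ((mat 1 - torus 0) *v v) x + symp_form v ((mat 1 - torus 0) *v x) = symp_form v x"
  by (simp add: symp_form_def torus_mult_vec_nth matrix_vector_mult_diff_rdistrib flip: sum.distrib)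

text \<open>Conjugating the projection, which lies in \<open>gsp\<close> but not in \<open>sp\<close>, detects the Dickson
  invariant; this is what kills the one \<open>S\<^sub>2\<^sub>g\<^sub>+\<^sub>1\<close>-coinvariant of \<open>sp\<close>.\<close>

lemma transv_conj_proj:
  fixes v :: "bit ^ ('g::finite + 'g)"
  defines "D \<equiv> mat 1 - torus 0"
  shows "transv 1 v ** D ** transv 1 v + D =
    (if symp_form v (D *v v) = 1 then 0 else tens v v) + (tens v (D *v v) + tens (D *v v) v)"
proof -
  \<comment> \<open>Moving \<open>D\<close> across the form costs the term
    \<open>symp_form v x\<close>.\<close>
  have *: "symp_form v (D *v x) = symp_form v x + symp_form (D *v v) x" for x
    using symp_form_proj[of v x] unfolding D_def by (metis add_diff_cancel_left' add.commute minus_bit_def)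
  have "symp_form (D *v v) v = symp_form v (D *v v)" by (rule symp_form_bit_commute)
  then show ?thesis
    by (cases "symp_form v (D *v v)")
      (simp_all add: matrix_eq transv_mult_vec symp_form_linear * vec_eq_iff algebra_simps
      matrix_vector_right_distrib vector_scalar_commute matrix_vector_mult_add_rdistrib
      flip: matrix_vector_mul_assoc)
qed

text \<open>Over the field with two elements the only scalars are 0 and 1, so this describes linear
  subspaces.\<close>

locale bit_mat_subgroup =
  fixes M :: "(bit ^ 'n ^ 'm) set"
  assumes zero_mem [simp]: "0 \<in> M"
    and add_mem: "A \<in> M \<Longrightarrow> A' \<in> M \<Longrightarrow> A + A' \<in> M"
begin

lemma sum_mem: "(\<And>i. i \<in> I \<Longrightarrow> f i \<in> M) \<Longrightarrow> (\<Sum>i\<in>I. f i) \<in> M"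
  by (induction I rule: infinite_finite_induct) (auto intro: add_mem)

lemma symmetric_double_sum_mem:
  assumes "finite I" "\<And>i. F i i \<in> M" "\<And>i j. F i j + F j i \<in> M"
  shows "(\<Sum>i\<in>I. \<Sum>j\<in>I. F i j) \<in> M"
  using assms(1)
proof induction
  case (insert a I)
  have "(\<Sum>i\<in>insert a I. \<Sum>j\<in>insert a I. F i j) =
      F a a + (\<Sum>i\<in>I. F a i + F i a) + (\<Sum>i\<in>I. \<Sum>j\<in>I. F i j)"
    using insert by (simp add: sum.distrib add_ac)
  then show ?case by (simp only:) (intro add_mem sum_mem assms insert.IH)
qed simp

end

lemma tens_axis_bit:
  "tens (axis i 1) (axis j 1) =
    (\<chi> k m. if k = i \<and> m = sum_swap j then 1 else (0 :: bit))"
proof -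
  have "symp_form (axis j 1) (axis m 1) = (if m = sum_swap j then 1 else (0 :: bit))" for m
    by (cases m; cases j; simp add: uminus_bit_def; simp add: axis_def)
  then show ?thesis by (simp add: tens_def vec_eq_iff) (simp add: axis_def)
qed

text \<open>Elements of \<open>sp\<close> correspond to symmetric tensors. Such a tensor is a sum of
  diagonal terms \<open>tens v v\<close> and symmetric pairs \<open>tens v w + tens w v\<close>, and
  polarization obtains the pairs from the squares.\<close>

lemma symplectic_lie_algebra_bit_spanned:
  fixes M :: "(bit ^ ('g::finite + 'g) ^ ('g + 'g)) set"
  assumes "bit_mat_subgroup M" and E: "\<And>v. tens v v \<in> M"
    and A: "\<And>x y. symp_form (A *v x) y + symp_form x (A *v y) = 0"
  shows "A \<in> M"
proof -
  interpret bit_mat_subgroup M by fact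
  define F where "F i j = (if A $ i $ sum_swap j = 1 then tens (axis i 1) (axis j 1) else (0 :: bit ^ _ ^ _))"
    for i j
  have P: "tens v w + tens w v \<in> M" for v w
  proof -
    have "tens v w + tens w v = tens (v + w) (v + w) + (tens v v + tens w w)"
      by (simp add: tens_add_left tens_add_right add_ac)
    then show ?thesis by (simp add: add_mem E)
  qed
  \<comment> \<open>Membership in \<open>sp\<close> means symmetry once the columns are permuted by
    \<open>sum_swap\<close>; signs are invisible in characteristic two.\<close>
  have sym: "A $ i $ sum_swap j = A $ j $ sum_swap i" for i j
  proof -
    have pair: "symp_form v (axis (sum_swap m) 1) = v $ m" for v :: "bit ^ ('g + 'g)" and m
      by (cases m) (simp_all add: uminus_bit_def)
    have "symp_form (A *v axis (sum_swap j) 1) (axis (sum_swap i) 1) =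
        symp_form (A *v axis (sum_swap i) 1) (axis (sum_swap j) 1)"
      using A[of "axis (sum_swap j) 1" "axis (sum_swap i) 1"] symp_form_bit_commute
      by (metis add_eq_0_iff uminus_bit_def id_apply)
    then show ?thesis unfolding pair by (simp add: matrix_vector_mult_axis)
  qed
  have "A = (\<Sum>i\<in>UNIV. \<Sum>j\<in>UNIV. F i j)"
  proof -
    have "(\<Sum>i\<in>UNIV. \<Sum>j\<in>UNIV. F i j $ k $ m) = A $ k $ m" for k m
    proof -
      have "F i j $ k $ m = (if j = sum_swap m then if i = k then A $ k $ m else 0 else 0)" for i j
        unfolding F_def tens_axis_bit by (cases "A $ i $ sum_swap j") auto
      then show ?thesis by simp
    qed
    then show ?thesis by (simp add: vec_eq_iff)
  qed
  also have "\<dots> \<in> M"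
    by (rule symmetric_double_sum_mem) (auto simp: F_def E sym P)
  finally show ?thesis .
qed

text \<open>\<open>M\<close> stands for the classes realised by commutators and \<open>B\<close> for
  the roots. Besides the commutator hypotheses, two facts about the symmetric group enter:
  \<open>gen\<close>, additive generation by roots, and \<open>link\<close>, which joins distinct
  orthogonal roots through a root pairing to one with both.\<close>

lemma transvection_conjugates_span:
  fixes M :: "(bit ^ ('g::finite + 'g) ^ ('g + 'g)) set" and B :: "(bit ^ ('g + 'g)) set"
  assumes "bit_mat_subgroup M"
    and conj: "\<And>v w. w \<in> B \<Longrightarrow> transv 1 w ** tens v v ** transv 1 w + tens v v \<in> M"
    and proj: "\<And>w. w \<in> B \<Longrightarrow>
      transv 1 w ** (mat 1 - torus 0) ** transv 1 w + (mat 1 - torus 0) \<in> M"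
    and gen: "\<And>K u. 0 \<in> K \<Longrightarrow> (\<And>x y. x \<in> K \<Longrightarrow> y \<in> K \<Longrightarrow> x + y \<in> K) \<Longrightarrow> B \<subseteq> K \<Longrightarrow> u \<in> K"
    and link: "\<And>v w. v \<in> B \<Longrightarrow> w \<in> B \<Longrightarrow> v \<noteq> w \<Longrightarrow> symp_form v w = 0 \<Longrightarrow>
      \<exists>u\<in>B. symp_form v u = 1 \<and> symp_form u w = 1 \<and> u + w \<in> B"
  shows "tens u u \<in> M"
proof -
  interpret bit_mat_subgroup M by fact
  define P where "P v w = tens v w + tens w v" for v w :: "bit ^ ('g + 'g)"
  have P_add: "P v (x + y) = P v x + P v y" for v x y
    by (simp add: P_def tens_add_left tens_add_right add_ac)
  have P_commute: "P v w = P w v" for v w by (simp add: P_def add.commute)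
  have P_zero [simp]: "P v 0 = 0" for v by (simp add: P_def tens_def vec_eq_iff)
  have E_add: "tens (v + w) (v + w) = P v w + (tens v v + tens w w)" for v w
    by (simp add: P_def tens_add_left tens_add_right add_ac)
  \<comment> \<open>The transvection along either root maps the other to \<open>v + w\<close>, so
    the tensor squares of \<open>v\<close>, \<open>w\<close> and \<open>v + w\<close> all agree
    modulo \<open>M\<close>.\<close>
  have adj: "tens v v + tens w w \<in> M" "P v w + tens v v \<in> M"
    if "v \<in> B" "w \<in> B" "symp_form v w = 1" for v w
  proof -
    have wv: "symp_form w v = 1" using that(3) by (simp add: symp_form_bit_commute)
    have "transv 1 w *v v = v + w" "transv 1 v *v w = v + w"
      using that(3) wv by (simp_all add: transv_mult_vec add.commute)
    then have *: "tens (v + w) (v + w) + tens v v \<in> M" "tens (v + w) (v + w) + tens w w \<in> M"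
      using conj[OF that(2), of v] conj[OF that(1), of w] unfolding transv_conj_tens by simp_all
    show "tens v v + tens w w \<in> M"
      using add_mem[OF *] by (simp add: add_ac)
    show "P v w + tens v v \<in> M"
      using *(2) by (simp add: E_add add_ac)
  qed
  have P_root: "P v w + (if symp_form v w = 1 then tens v v else 0) \<in> M"
    if v: "v \<in> B" and w: "w \<in> B" for v w
  proof -
    consider "symp_form v w = 1" | "v = w" | "symp_form v w = 0" "v \<noteq> w"
      by (cases "symp_form v w") auto
    then show ?thesis
    proof cases
      case 1
      then show ?thesis using adj(2)[OF v w] by simp
    next
      case 2
      then show ?thesis by (simp add: P_def)
    next
      case 3
      then obtain u where u: "u \<in> B" "symp_form v u = 1" "symp_form u w = 1" "u + w \<in> B"
        using link[OF v w] by blast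
      \<comment> \<open>Here \<open>w\<close> is split as \<open>u + (u + w)\<close>, two roots that
        both pair to one with \<open>v\<close>; their two contributions \<open>tens v v\<close>
        cancel.\<close>
      have "P v (u + w) + tens v v \<in> M"
        using adj(2)[OF v u(4)] 3 u(2) by (simp add: symp_form_linear)
      from add_mem[OF adj(2)[OF v u(1,2)] this] have "P v w \<in> M"
        by (simp add: P_add add_ac)
      then show ?thesis using 3 by simp
    qed
  qed
  \<comment> \<open>The correction term is \<open>symp_form v u\<close> times
    \<open>tens v v\<close>, which is additive in \<open>u\<close>, so \<open>gen\<close> extends
    the relation from roots to all vectors.\<close>
  have P_all: "P v u + (if symp_form v u = 1 then tens v v else 0) \<in> M" if "v \<in> B" for v u
  proof -
    have "u \<in> {u. P v u + (if symp_form v u = 1 then tens v v else 0) \<in> M}"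
    proof (rule gen)
      fix x y
      assume "x \<in> {u. P v u + (if symp_form v u = 1 then tens v v else 0) \<in> M}"
        "y \<in> {u. P v u + (if symp_form v u = 1 then tens v v else 0) \<in> M}"
      then have *: "(P v x + (if symp_form v x = 1 then tens v v else 0)) +
          (P v y + (if symp_form v y = 1 then tens v v else 0)) \<in> M"
        using add_mem by blast
      show "x + y \<in> {u. P v u + (if symp_form v u = 1 then tens v v else 0) \<in> M}"
        using * by (cases "symp_form v x"; cases "symp_form v y")
          (simp_all add: symp_form_linear P_add add_ac)
    qed (use P_root[OF that] in \<open>simp_all add: subset_iff\<close>)
    then show ?thesis by simp
  qed
  \<comment> \<open>With \<open>s = symp_form v d\<close>, the projection gives
    \<open>(1 + s) tens v v + P v d\<close> and \<open>P_all\<close> gives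
    \<open>P v d + s tens v v\<close>. Their sum is \<open>tens v v\<close> for either value of
    \<open>s\<close>.\<close>
  have E_root: "tens v v \<in> M" if "v \<in> B" for v
  proof -
    define d where "d = (mat 1 - torus 0) *v v"
    have "(if symp_form v d = 1 then 0 else tens v v) + P v d \<in> M"
      using proj[OF that] unfolding transv_conj_proj d_def P_def .
    from add_mem[OF this P_all[OF that, of d]] show ?thesis
      by (cases "symp_form v d") (simp_all add: add_ac)
  qed
  have P_root_mem: "P v u \<in> M" if "v \<in> B" for v u
    using add_mem[OF P_all[OF that, of u] E_root[OF that]] P_all[OF that, of u]
    by (cases "symp_form v u") (simp_all add: add_ac)
  \<comment> \<open>Symmetry of \<open>P\<close> and a second use of \<open>gen\<close> release the
    other argument from being a root.\<close>
  have P_mem: "P v u \<in> M" for v u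
  proof -
    have *: "P u w \<in> M" if "w \<in> B" for w
      using P_root_mem[OF that, of u] P_commute[of u w] by simp
    have "v \<in> {v. P u v \<in> M}"
      by (rule gen) (use * in \<open>auto simp: P_add intro: add_mem\<close>)
    then show ?thesis using P_commute[of u v] by simp
  qed
  have [simp]: "tens 0 0 = (0 :: bit ^ ('g + 'g) ^ ('g + 'g))"
    by (simp add: tens_def vec_eq_iff)
  \<comment> \<open>\<open>tens u u\<close> is quadratic in \<open>u\<close> with polarization
    \<open>P\<close>, so by \<open>P_mem\<close> this set is additively closed.\<close>
  have "u \<in> {u. tens u u \<in> M}"
    by (rule gen) (use E_root P_mem in \<open>auto simp: E_add intro: add_mem\<close>)
  then show ?thesis by simp
qed

section \<open>Transpositions act as transvections\<close>

lemma dot2_axis: "dot2 (axis i 1) v = v $ i"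
  by (simp add: dot2_def axis_def if_distrib[of "\<lambda>x. x * _"] cong: if_cong)

lemma dot2_add_left: "dot2 (u + v) w = dot2 u w + dot2 v w"
  and dot2_smult_left: "dot2 (c *s v) w = c * dot2 v w"
  by (simp_all add: dot2_def algebra_simps sum.distrib sum_distrib_left)

lemma ones_perp_add: "v \<in> ones_perp \<Longrightarrow> w \<in> ones_perp \<Longrightarrow> v + w \<in> ones_perp"
  and ones_perp_smult: "v \<in> ones_perp \<Longrightarrow> c *s v \<in> ones_perp"
  and ones_perp_zero: "0 \<in> ones_perp"
  by (simp_all add: ones_perp_def dot2_add_left dot2_smult_left) (simp add: dot2_def)

text \<open>This freedom in the representative is used to make the coordinate \<open>l\<close>
  vanish.\<close>

lemma ones_class_add_all_ones: "ones_class (v + all_ones) = ones_class v"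
proof (intro equalityI subsetI)
  fix x assume "x \<in> ones_class (v + all_ones)"
  then obtain s where s: "s \<in> vec.span {all_ones}" "x = v + (all_ones + s)"
    by (auto simp: ones_class_def add.assoc)
  then show "x \<in> ones_class v"
    using vec.span_add[OF vec.span_base[of all_ones "{all_ones}"] s(1)] by (auto simp: ones_class_def)
next
  fix x assume "x \<in> ones_class v"
  then obtain s where s: "s \<in> vec.span {all_ones}" "x = v + s"
    by (auto simp: ones_class_def)
  then have "x = v + all_ones + (s - all_ones)" by simp
  moreover have "s - all_ones \<in> vec.span {all_ones}"
    by (rule vec.span_diff[OF s(1) vec.span_base]) simp
  ultimately show "x \<in> ones_class (v + all_ones)"
    unfolding ones_class_def by (rule image_eqI)
qed

text \<open>For \<open>i = j\<close> the vector is zero in characteristic two, which is convenient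
  when everything is expanded around one base coordinate.\<close>

definition axis_pair :: "'m \<Rightarrow> 'm \<Rightarrow> bit ^ 'm::finite"
  where "axis_pair i j = axis i 1 + axis j 1"

lemma axis_pair_in_ones_perp: "axis_pair i j \<in> ones_perp"
  by (simp add: ones_perp_def axis_pair_def dot2_add_left dot2_axis all_ones_def)

lemma dot2_axis_pair: "dot2 (axis_pair i j) v = v $ i + v $ j"
  by (simp add: axis_pair_def dot2_add_left dot2_axis)

lemma axis_pair_nth: "axis_pair i j $ k = (if k = i then 1 else 0) + (if k = j then 1 else 0)"
  by (simp add: axis_pair_def axis_def)

lemma bit_vec_add_self [simp]: "v + v = (0 :: bit ^ 'n)"
  by (simp add: vec_eq_iff)

text \<open>Swapping two coordinates changes a vector only if they differ, and then it flips both.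
  The right-hand side is the transvection formula for the dot product.\<close>

lemma permute_coords_transpose:
  "permute_coords (Transposition.transpose i j) v = v + dot2 (axis_pair i j) v *s axis_pair i j"
proof -
  have inv: "inv_into UNIV (Transposition.transpose i j) = Transposition.transpose i j"
    by (rule inv_unique_comp) (simp_all add: fun_eq_iff)
  have "x + (x + y) = y" for x y :: bit by (simp flip: add.assoc)
  then have "v $ Transposition.transpose i j k = v $ k + (v $ i + v $ j) * axis_pair i j $ k" for k
    by (cases "k = i"; cases "k = j") (simp_all add: axis_pair_nth add_ac)
  then show ?thesis
    by (simp add: vec_eq_iff permute_coords_def inv dot2_axis_pair distrib_right)
qed

locale symplectic_W =
  fixes \<iota> :: "(bit ^ 'm::finite) set \<Rightarrow> bit ^ ('g::finite + 'g)" and l :: 'm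
  assumes ident: "symp_identification \<iota>" and card_m: "CARD('m) = 2 * CARD('g) + 2"
begin

definition \<kappa> :: "bit ^ 'm \<Rightarrow> bit ^ ('g + 'g)"
  where "\<kappa> v = \<iota> (ones_class v)"

lemma \<kappa>_add: "v \<in> ones_perp \<Longrightarrow> w \<in> ones_perp \<Longrightarrow> \<kappa> (v + w) = \<kappa> v + \<kappa> w"
  and \<kappa>_smult: "v \<in> ones_perp \<Longrightarrow> \<kappa> (c *s v) = c *s \<kappa> v"
  and symp_form_\<kappa>: "v \<in> ones_perp \<Longrightarrow> w \<in> ones_perp \<Longrightarrow> symp_form (\<kappa> v) (\<kappa> w) = dot2 v w"
  using ident by (simp_all add: symp_identification_def \<kappa>_def)

lemma \<kappa>_zero [simp]: "\<kappa> 0 = 0"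
  using \<kappa>_smult[OF ones_perp_zero, of 0] by simp

text \<open>The transvections along these vectors are the transpositions of
  \<open>S\<^sub>2\<^sub>g\<^sub>+\<^sub>1\<close>; hence the exclusion of \<open>l\<close>.\<close>

definition roots :: "(bit ^ ('g + 'g)) set"
  where "roots = {\<kappa> (axis_pair i j) | i j. i \<noteq> j \<and> i \<noteq> l \<and> j \<noteq> l}"

lemma transv_root_in_sym_stabilizer:
  assumes "w \<in> roots"
  shows "transv 1 w \<in> sym_stabilizer \<iota> l"
proof -
  obtain i j where ij: "w = \<kappa> (axis_pair i j)" "i \<noteq> l" "j \<noteq> l"
    using assms by (auto simp: roots_def)
  have "acts_as_perm \<iota> (transv 1 w) (Transposition.transpose i j)"
    unfolding acts_as_perm_def
  proof
    fix v :: "bit ^ 'm" assume v: "v \<in> ones_perp"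
    show "transv 1 w *v \<iota> (ones_class v) =
        \<iota> (ones_class (permute_coords (Transposition.transpose i j) v))"
      unfolding \<kappa>_def[symmetric] permute_coords_transpose
      using v by (simp add: ij transv_mult_vec symp_form_\<kappa> axis_pair_in_ones_perp \<kappa>_add \<kappa>_smult
          ones_perp_smult)
  qed
  moreover have "Transposition.transpose i j permutes UNIV"
    by (rule permutes_swap_id) auto
  ultimately show ?thesis
    using ij by (auto simp: sym_stabilizer_def Transposition.transpose_def
        intro!: exI[of _ "Transposition.transpose i j"])
qed

text \<open>Orthogonality means that the index pairs meet in an even number of points, and
  \<open>v \<noteq> w\<close> then makes them disjoint. The link between \<open>e_i + e_j\<close>
  and \<open>e_k + e_m\<close> is \<open>e_i + e_k\<close>.\<close>

lemma roots_link:
  assumes "v \<in> roots" "w \<in> roots" "v \<noteq> w" "symp_form v w = 0"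
  shows "\<exists>u\<in>roots. symp_form v u = 1 \<and> symp_form u w = 1 \<and> u + w \<in> roots"
proof -
  obtain i j where ij: "v = \<kappa> (axis_pair i j)" "i \<noteq> l" "j \<noteq> l" "i \<noteq> j"
    using assms by (auto simp: roots_def)
  obtain k m where km: "w = \<kappa> (axis_pair k m)" "k \<noteq> l" "m \<noteq> l" "k \<noteq> m"
    using assms by (auto simp: roots_def)
  have "axis_pair k m $ i + axis_pair k m $ j = 0"
    using assms(4) by (simp add: ij km symp_form_\<kappa> axis_pair_in_ones_perp dot2_axis_pair)
  moreover have "\<not> (i = k \<and> j = m)" "\<not> (i = m \<and> j = k)"
    using assms(3) ij km by (auto simp: axis_pair_def add.commute)
  ultimately have ne: "i \<noteq> k" "i \<noteq> m" "j \<noteq> k" "j \<noteq> m"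
    using ij km by (auto simp: axis_pair_nth split: if_splits)
  have "axis_pair i k + axis_pair k m = axis_pair i m"
    by (simp add: axis_pair_def vec_eq_iff add_ac)
  then have sum: "\<kappa> (axis_pair i k) + w = \<kappa> (axis_pair i m)"
    by (metis \<kappa>_add axis_pair_in_ones_perp km(1))
  show ?thesis
  proof (intro bexI conjI)
    show "symp_form v (\<kappa> (axis_pair i k)) = 1" "symp_form (\<kappa> (axis_pair i k)) w = 1"
      using ne ij km
      by (simp_all add: symp_form_\<kappa> axis_pair_in_ones_perp dot2_axis_pair axis_pair_nth)
    show "\<kappa> (axis_pair i k) + w \<in> roots" "\<kappa> (axis_pair i k) \<in> roots"
      unfolding sum using ne ij km by (auto simp: roots_def)
  qed
qed

text \<open>If the coordinate \<open>l\<close> is one, add the all-ones vector. It is orthogonal to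
  itself because the number \<open>2g + 2\<close> of coordinates is even.\<close>

lemma \<kappa>_surj: obtains v where "v \<in> ones_perp" "v $ l = 0" "\<kappa> v = u"
proof -
  have "u \<in> \<iota> ` W_space"
    using ident by (simp add: symp_identification_def bij_betw_def)
  then obtain v where v: "v \<in> ones_perp" "\<kappa> v = u"
    by (auto simp: W_space_def \<kappa>_def)
  show thesis
  proof (cases "v $ l")
    case zero
    then show thesis using v that by blast
  next
    case one
    have "of_nat CARD('m) = (0 :: bit)" by (simp add: card_m)
    then have "all_ones \<in> (ones_perp :: (bit ^ 'm) set)"
      by (simp add: ones_perp_def dot2_def all_ones_def)
    then have "v + all_ones \<in> ones_perp" using v by (simp add: ones_perp_add)
    moreover have "(v + all_ones) $ l = 0" using one by (simp add: all_ones_def)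
    moreover have "\<kappa> (v + all_ones) = u" using v by (simp add: \<kappa>_def ones_class_add_all_ones)
    ultimately show thesis using that by blast
  qed
qed

lemma roots_generate:
  assumes K: "0 \<in> K" "\<And>x y. x \<in> K \<Longrightarrow> y \<in> K \<Longrightarrow> x + y \<in> K" "roots \<subseteq> K"
  shows "u \<in> K"
proof -
  obtain v where v: "v \<in> ones_perp" "v $ l = 0" "\<kappa> v = u" by (rule \<kappa>_surj)
  have "\<exists>k :: 'm. k \<noteq> l"
  proof (rule ccontr)
    assume "\<nexists>k. k \<noteq> l"
    then have "UNIV = {l}" by auto
    then have "CARD('m) = card {l}" by simp
    then show False by (simp add: card_m)
  qed
  then obtain k where k: "k \<noteq> l" by blast
  \<comment> \<open>Expansion around a base coordinate \<open>k\<close>: the multiples of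
    \<open>e_k\<close> cancel because the coordinates of \<open>v\<close> away from \<open>l\<close>
    sum to zero.\<close>
  define p where "p I = (\<Sum>i\<in>I. v $ i *s axis_pair i k)" for I
  have "p I \<in> ones_perp \<and> \<kappa> (p I) \<in> K" if "finite I" "l \<notin> I" for I
    using that
  proof (induction rule: finite_induct)
    case empty
    show ?case using K(1) by (simp add: p_def ones_perp_zero)
  next
    case (insert i I)
    have "\<kappa> (v $ i *s axis_pair i k) \<in> K"
    proof (cases "v $ i = 0 \<or> i = k")
      case True
      then have *: "v $ i *s axis_pair i k = 0" by (auto simp: axis_pair_def)
      show ?thesis unfolding * using K(1) by simp
    next
      case False
      then show ?thesis using K(3) k insert.prems by (auto simp: roots_def)
    qed
    moreover have "v $ i *s axis_pair i k \<in> ones_perp"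
      by (simp add: ones_perp_smult axis_pair_in_ones_perp)
    ultimately show ?case
      using insert K(2) by (simp add: p_def \<kappa>_add ones_perp_add)
  qed
  then have "\<kappa> (p (UNIV - {l})) \<in> K" by simp
  moreover have "p (UNIV - {l}) = v"
  proof -
    have "(\<Sum>i\<in>UNIV. v $ i) = 0" using v(1) by (simp add: ones_perp_def dot2_def all_ones_def)
    then have s: "(\<Sum>i\<in>UNIV - {l}. v $ i) = 0" using v(2) by (simp add: sum_diff1)
    have "p (UNIV - {l}) $ m = v $ m" for m
    proof -
      have "p (UNIV - {l}) $ m =
          (\<Sum>i\<in>UNIV - {l}. if m = i then v $ i else 0) + (\<Sum>i\<in>UNIV - {l}. if m = k then v $ i else 0)"
        by (simp add: p_def axis_pair_nth distrib_left sum.distrib if_distrib[of "(*) _"] cong: if_cong)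
      also have "\<dots> = v $ m" using s v(2) by (cases "m = k") auto
      finally show ?thesis .
    qed
    then show ?thesis by (simp add: vec_eq_iff)
  qed
  ultimately show ?thesis using v(3) by simp
qed

end

section \<open>The multiplier homomorphism\<close>

lemma z2_units_simps [simp]:
  "u \<in> carrier z2_units \<longleftrightarrow> u dvd 1" "u \<otimes>\<^bsub>z2_units\<^esub> v = u * v" "\<one>\<^bsub>z2_units\<^esub> = 1"
  by (simp_all add: z2_units_def)

lemma comm_group_z2_units: "comm_group z2_units"
proof (rule comm_groupI)
  fix u v assume "u \<in> carrier z2_units" "v \<in> carrier z2_units"
  then show "u \<otimes>\<^bsub>z2_units\<^esub> v \<in> carrier z2_units" using mult_dvd_mono[of u 1 v 1] by simp
next
  fix u assume "u \<in> carrier z2_units"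
  then obtain v where "1 = u * v" by (auto elim: dvdE)
  then show "\<exists>v\<in>carrier z2_units. v \<otimes>\<^bsub>z2_units\<^esub> u = \<one>\<^bsub>z2_units\<^esub>"
    by (intro bexI[of _ v]) (simp_all add: mult.commute dvdI[of 1 v u])
qed (simp_all add: mult_ac)

lemma multiplier_group_hom:
  "group_hom GSp z2_units (multiplier :: z2adic ^ ('g::finite + 'g) ^ ('g + 'g) \<Rightarrow> _)"
  unfolding group_hom_def group_hom_axioms_def
  by (auto simp: group_GSp comm_group_z2_units comm_group.axioms(2) hom_def multiplier_mult
      carrier_GSp_multiplier(2))

section \<open>The derived subgroup contains the congruence kernel\<close>

locale full_preimage =
  fixes H :: "(z2adic ^ ('g::finite + 'g) ^ ('g + 'g)) set"
  assumes subgroup_H: "subgroup H GSp"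
    and full: "S \<in> carrier GSp \<Longrightarrow> red2_mat S \<in> red2_mat ` H \<Longrightarrow> S \<in> H"
begin

sublocale group "GSp :: (z2adic ^ ('g + 'g) ^ ('g + 'g)) monoid"
  by (rule group_GSp)

abbreviation DH where "DH \<equiv> derived GSp H"

lemma H_subset: "S \<in> H \<Longrightarrow> S \<in> carrier GSp"
  using subgroup.subset[OF subgroup_H] by blast

lemma subgroup_DH: "subgroup DH GSp"
  by (rule derived_is_subgroup) (use H_subset in blast)

lemma DH_subset_H: "DH \<subseteq> H"
  by (rule derived_incl[OF subset_refl subgroup_H])

lemma one_in_DH: "mat 1 \<in> DH"
  using subgroup.one_closed[OF subgroup_DH] by simp

lemma mult_in_DH: "x \<in> DH \<Longrightarrow> y \<in> DH \<Longrightarrow> x ** y \<in> DH"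
  using subgroup.m_closed[OF subgroup_DH] by simp

lemma DH_multiplier:
  assumes "x \<in> DH"
  shows "multiplier x = 1"
proof -
  interpret mult: group_hom GSp z2_units multiplier by (rule multiplier_group_hom)
  interpret U: comm_group z2_units by (rule comm_group_z2_units)
  have "multiplier ` H \<subseteq> carrier z2_units"
    using carrier_GSp_multiplier(2)[OF H_subset] by auto
  then have "derived z2_units (multiplier ` H) = {1}"
    using U.derived_eq_singleton by simp
  moreover have "derived z2_units (multiplier ` H) = multiplier ` DH"
    by (rule mult.derived_img) (use H_subset in blast)
  ultimately show ?thesis using assms by blast
qed

text \<open>Elements of every multiplier are covered, so commutators may be formed with torus
  elements as well.\<close>

lemma kernel_in_H:
  assumes "S \<in> carrier GSp" "red2_mat S = mat 1"
  shows "S \<in> H"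
proof (rule full[OF assms(1)])
  have "mat 1 \<in> H" using subgroup.one_closed[OF subgroup_H] by simp
  then show "red2_mat S \<in> red2_mat ` H" unfolding assms(2) by (metis imageI red2_mat_one)
qed

text \<open>The commutator is the product of a conjugate of \<open>k\<close>, with class
  \<open>T A T\<close>, and the inverse of \<open>k\<close>, with class \<open>A\<close>.\<close>

lemma commutator_graded_class:
  assumes h: "h \<in> H" and k: "k \<in> H" "graded_class n k A" and n: "n \<ge> 1"
    and T: "T ** T = mat 1" "red2_mat h = T"
  shows "\<exists>z\<in>DH. graded_class n z (T ** A ** T + A)"
proof (intro bexI)
  let ?h' = "inv\<^bsub>GSp\<^esub> h" and ?k' = "inv\<^bsub>GSp\<^esub> k"
  have "h ** k ** ?h' ** ?k' \<in> derived_set GSp H" using h k by auto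
  then show "h ** k ** ?h' ** ?k' \<in> DH"
    unfolding derived_def by (rule generate.incl)
  have hh: "h ** ?h' = mat 1" using inverse_GSp(1)[OF H_subset[OF h]] .
  have "T ** red2_mat ?h' = mat 1"
    using arg_cong[OF hh, of red2_mat] T(2) by simp
  then have "red2_mat ?h' = T"
    using T(1) by (metis matrix_mul_assoc matrix_mul_lid matrix_mul_rid)
  then show "graded_class n (h ** k ** ?h' ** ?k') (T ** A ** T + A)"
    using graded_class_mult[OF graded_class_conj[OF k(2) hh]
        graded_class_inverse[OF k(2) inverse_GSp(1)[OF H_subset[OF k(1)]] n] n] T(2) by simp
qed

lemma bit_mat_subgroup_graded:
  assumes "n \<ge> 1"
  shows "bit_mat_subgroup {A. \<exists>z\<in>DH. graded_class n z A}"
proof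
  have "graded_class n (mat 1) 0"
    unfolding graded_class_def by (rule exI[of _ 0]) (simp add: vec_eq_iff)
  then show "0 \<in> {A. \<exists>z\<in>DH. graded_class n z A}" using one_in_DH by blast
  show "A + A' \<in> {A. \<exists>z\<in>DH. graded_class n z A}"
    if "A \<in> {A. \<exists>z\<in>DH. graded_class n z A}" "A' \<in> {A. \<exists>z\<in>DH. graded_class n z A}" for A A'
    using that graded_class_mult[OF _ _ assms] mult_in_DH by blast
qed

end

locale full_preimage_sym = full_preimage H + symplectic_W \<iota> l
  for H :: "(z2adic ^ ('g::finite + 'g) ^ ('g + 'g)) set"
    and \<iota> :: "(bit ^ 'm::finite) set \<Rightarrow> bit ^ ('g + 'g)" and l :: 'm +
  assumes sym_in: "sym_stabilizer \<iota> l \<subseteq> red2_mat ` H"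
begin

lemma graded_class_surj:
  assumes n: "n \<ge> 1" and A: "\<And>x y. symp_form (A *v x) y + symp_form x (A *v y) = 0"
  shows "\<exists>z\<in>DH. graded_class n z A"
proof -
  define M where "M = {A. \<exists>z\<in>DH. graded_class n z A}"
  have M: "bit_mat_subgroup M"
    unfolding M_def by (rule bit_mat_subgroup_graded[OF n])
  have comm: "transv 1 w ** B ** transv 1 w + B \<in> M"
    if w: "w \<in> roots" and k: "k \<in> carrier GSp" "graded_class n k B" for w k B
  proof -
    obtain h where h: "h \<in> H" "red2_mat h = transv 1 w"
      using transv_root_in_sym_stabilizer[OF w] sym_in by (metis imageE subsetD)
    have "k \<in> H"
      by (rule kernel_in_H[OF k(1) graded_class_red2[OF k(2) n]])
    then show ?thesis
      unfolding M_def
      using commutator_graded_class[OF h(1) _ k(2) n transv_bit_involution h(2)] by blast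
  qed
  have "tens u u \<in> M" for u
  proof (rule transvection_conjugates_span[OF M _ _ roots_generate roots_link])
    fix v w :: "bit ^ ('g + 'g)" assume w: "w \<in> roots"
    obtain x where "red2_vec x = v" by (rule red2_vec_surj)
    then have "graded_class n (transv (2 ^ n) x) (tens v v)"
      using graded_class_transv[of n x] by simp
    then show "transv 1 w ** tens v v ** transv 1 w + tens v v \<in> M"
      by (rule comm[OF w transv_in_GSp])
  next
    fix w assume w: "w \<in> roots"
    \<comment> \<open>Since \<open>n \<ge> 1\<close>, the number \<open>1 + 2 ^ n\<close> is a unit,
      so the torus element is a genuine similitude.\<close>
    have "(2 :: z2adic) dvd 2 ^ n" using n by (intro dvd_power) auto
    then show "transv 1 w ** (mat 1 - torus 0) ** transv 1 w + (mat 1 - torus 0) \<in> M"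
      by (intro comm[OF w _ graded_class_torus] torus_in_GSp two_dvd_imp_one_plus_unit)
  qed
  then have "A \<in> M" by (rule symplectic_lie_algebra_bit_spanned[OF M _ A])
  then show ?thesis by (simp add: M_def)
qed

text \<open>Successive approximation: if \<open>y\<close> agrees with \<open>x\<close> modulo
  \<open>2 ^ n\<close>, the class of the error \<open>k\<close> in the graded piece is realised by
  some \<open>z\<close> in the derived subgroup, and \<open>y ** z\<close> is correct one level
  deeper.\<close>

lemma congruence_kernel_approx:
  assumes x: "x \<in> carrier Sp" "red2_mat x = mat 1"
  shows "\<exists>y\<in>DH. mat_cong n y x"
proof (induction n)
  case 0
  show ?case using one_in_DH by (auto simp: mat_cong_def)
next
  case (Suc n)
  show ?case
  \<comment> \<open>The graded argument starts at \<open>n = 1\<close>; at the first level the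
    identity already approximates \<open>x\<close>.\<close>
  proof (cases "n = 0")
    case True
    have "red2 (x $ i $ j) = mat 1 $ i $ j" for i j
      using x(2) by (metis map_matrix_nth)
    then have "red2 (mat 1 $ i $ j - x $ i $ j) = 0" for i j
      by (simp add: mat_def)
    then have "mat_cong 1 (mat 1) x" by (simp only: mat_cong_def red2_eq_0_iff) simp
    then show ?thesis using True one_in_DH by auto
  next
    case False
    then have n: "n \<ge> 1" by simp
    obtain y where y: "y \<in> DH" "mat_cong n y x" using Suc by blast
    have yG: "y \<in> carrier GSp" using y(1) DH_subset_H H_subset by blast
    have xG: "x \<in> carrier GSp" "multiplier x = 1" using x(1) by (simp_all add: carrier_Sp_iff)
    define k where "k = inv\<^bsub>GSp\<^esub> y ** x"
    have yk: "y ** k = x" using inverse_GSp(1)[OF yG] by (simp add: k_def matrix_mul_assoc)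
    have kG: "k \<in> carrier GSp" using m_closed[OF inv_closed[OF yG] xG(1)] by (simp add: k_def)
    have "mat_cong n (inv\<^bsub>GSp\<^esub> y ** y) k"
      unfolding k_def using y(2) by (intro mat_cong_mult) auto
    then have "mat_cong n k (mat 1)" using inverse_GSp(2)[OF yG] by (simp add: mat_cong_sym)
    then obtain A where A: "graded_class n k A" by (auto simp: mat_cong_one_iff)
    \<comment> \<open>The error must have multiplier one for its class to lie in \<open>sp\<close>,
      where \<open>graded_class_surj\<close> applies.\<close>
    have "multiplier y = 1"
      using y(1) DH_multiplier by blast
    then have "multiplier k = 1"
      using multiplier_mult[OF yG kG] xG yk by simp
    then have "is_multiplier k 1" using carrier_GSp_multiplier(1)[OF kG] by simp
    then obtain z where z: "z \<in> DH" "graded_class n z A"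
      using graded_class_surj[OF n graded_class_symplectic[OF A _ n]] by blast
    have zG: "z \<in> carrier GSp" using z(1) DH_subset_H H_subset by blast
    have "graded_class n (inv\<^bsub>GSp\<^esub> z ** k) 0"
      using graded_class_mult[OF graded_class_inverse[OF z(2) inverse_GSp(1)[OF zG] n] A n] by simp
    then have "mat_cong (Suc n) (inv\<^bsub>GSp\<^esub> z ** k) (mat 1)" by (rule graded_class_zero)
    then have "mat_cong (Suc n) (y ** z ** mat 1) (y ** z ** (inv\<^bsub>GSp\<^esub> z ** k))"
      by (intro mat_cong_mult) (auto intro: mat_cong_sym)
    moreover have "y ** z ** (inv\<^bsub>GSp\<^esub> z ** k) = x"
      using inverse_GSp(1)[OF zG] yk by (metis matrix_mul_assoc matrix_mul_lid)
    ultimately show ?thesis using mult_in_DH[OF y(1) z(1)] by auto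
  qed
qed

end

section \<open>The closure of the derived subgroup\<close>

context full_preimage
begin

lemma red2_DH: "red2_mat ` DH = derived GSp (red2_mat ` H)"
proof -
  interpret red: group_hom GSp GSp red2_mat by (rule red2_mat_group_hom)
  show ?thesis by (rule red.derived_img[symmetric]) (use H_subset in blast)
qed

lemma subgroup_red2_H: "subgroup (red2_mat ` H) GSp"
proof -
  interpret red: group_hom GSp GSp red2_mat by (rule red2_mat_group_hom)
  show ?thesis by (rule red.subgroup_img_is_subgroup[OF subgroup_H])
qed

end

text \<open>Both conditions on the right survive limits: the multiplier is one modulo every
  \<open>2 ^ n\<close>, and the reduction is determined at level one. Conversely, division by a
  commutator product \<open>y\<close> with the same reduction leaves an element of the congruence
  kernel, which is approximated as above.\<close>

lemma (in full_preimage_sym) closure_of_DH: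
  "top_of_set H closure_of DH = {S \<in> carrier Sp. red2_mat S \<in> derived GSp (red2_mat ` H)}"
proof (intro equalityI subsetI)
  fix S assume "S \<in> top_of_set H closure_of DH"
  then have S: "S \<in> H" "\<And>n. \<exists>Y\<in>DH. mat_cong n Y S"
    by (simp_all add: in_closure_of_mat_iff[OF DH_subset_H])
  have "2 ^ n dvd 1 - multiplier S" for n
  proof -
    obtain Y where Y: "Y \<in> DH" "mat_cong n Y S" using S(2) by blast
    then have "2 ^ n dvd multiplier Y - multiplier S"
      using DH_subset_H H_subset S(1) by (intro multiplier_cong) auto
    then show ?thesis using DH_multiplier[OF Y(1)] by simp
  qed
  then have "1 = multiplier S" by (rule z2adic_eqI)
  moreover obtain Y where "Y \<in> DH" "mat_cong 1 Y S" using S(2) by blast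
  then have "red2_mat S \<in> red2_mat ` DH" by (metis imageI mat_cong_imp_red2_eq order_refl)
  ultimately show "S \<in> {S \<in> carrier Sp. red2_mat S \<in> derived GSp (red2_mat ` H)}"
    using H_subset[OF S(1)] red2_DH by (simp add: carrier_Sp_iff)
next
  fix S assume "S \<in> {S \<in> carrier Sp. red2_mat S \<in> derived GSp (red2_mat ` H)}"
  then have S: "S \<in> carrier GSp" "multiplier S = 1" "red2_mat S \<in> red2_mat ` DH"
    by (simp_all add: red2_DH carrier_Sp_iff)
  obtain y where y: "y \<in> DH" "red2_mat S = red2_mat y" using S(3) by blast
  have yG: "y \<in> carrier GSp" using y(1) DH_subset_H H_subset by blast
  have SH: "S \<in> H" using S(1,3) DH_subset_H by (intro full) auto
  define x where "x = inv\<^bsub>GSp\<^esub> y ** S"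
  have yx: "y ** x = S" using inverse_GSp(1)[OF yG] by (simp add: x_def matrix_mul_assoc)
  have xG: "x \<in> carrier GSp" using m_closed[OF inv_closed[OF yG] S(1)] by (simp add: x_def)
  have "multiplier x = 1"
    using multiplier_mult[OF yG xG] DH_multiplier[OF y(1)] S(2) yx by simp
  then have x: "x \<in> carrier Sp" using xG by (simp add: carrier_Sp_iff)
  have "red2_mat x = red2_mat (inv\<^bsub>GSp\<^esub> y ** y)" by (simp add: x_def y(2))
  then have x1: "red2_mat x = mat 1" using inverse_GSp(2)[OF yG] by simp
  have "\<exists>Y\<in>DH. mat_cong n Y S" for n
  proof -
    obtain z where z: "z \<in> DH" "mat_cong n z x"
      using congruence_kernel_approx[OF x x1] by blast
    have "mat_cong n (y ** z) (y ** x)" using z(2) by (intro mat_cong_mult) auto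
    then show ?thesis using mult_in_DH[OF y(1) z(1)] yx by auto
  qed
  then show "S \<in> top_of_set H closure_of DH"
    using SH by (simp add: in_closure_of_mat_iff[OF DH_subset_H])
qed

section \<open>The topological abelianization\<close>

lemma topspace_quot_topology: "topspace (quot_topology X q) = q ` topspace X"
proof (rule equalityI)
  show "topspace (quot_topology X q) \<subseteq> q ` topspace X"
    using openin_topspace[of "quot_topology X q", unfolded openin_quot_topology] by blast
  have "{x \<in> topspace X. q x \<in> q ` topspace X} = topspace X" by auto
  then show "q ` topspace X \<subseteq> topspace (quot_topology X q)"
    by (intro openin_subset) (simp add: openin_quot_topology)
qed

text \<open>Openness descends to the factor map because the image of \<open>V\<close> under it
  equals the image under \<open>f\<close> of the preimage of \<open>V\<close> under
  \<open>q\<close>.\<close>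

lemma homeomorphic_map_quot_topology:
  assumes cont: "continuous_map X Y f" and opn: "open_map X Y f"
    and surj: "f ` topspace X = topspace Y"
    and eq: "\<And>x. x \<in> topspace X \<Longrightarrow> \<Psi> (q x) = f x"
    and inj: "inj_on \<Psi> (q ` topspace X)"
  shows "homeomorphic_map (quot_topology X q) Y \<Psi>"
proof (rule bijective_open_imp_homeomorphic_map)
  show "continuous_map (quot_topology X q) Y \<Psi>"
    unfolding continuous_map topspace_quot_topology
  proof (intro conjI allI impI)
    show "\<Psi> ` (q ` topspace X) \<subseteq> topspace Y"
      using eq surj by auto
    fix U assume "openin Y U"
    then have "openin X {x \<in> topspace X. f x \<in> U}"
      using cont by (simp add: continuous_map)
    moreover have "{x \<in> topspace X. q x \<in> {c \<in> q ` topspace X. \<Psi> c \<in> U}} = {x \<in> topspace X. f x \<in> U}"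
      by (rule Collect_cong) (auto simp: eq[symmetric])
    ultimately show "openin (quot_topology X q) {c \<in> q ` topspace X. \<Psi> c \<in> U}"
      by (auto simp: openin_quot_topology)
  qed
  show "open_map (quot_topology X q) Y \<Psi>"
    unfolding open_map_def
  proof (intro allI impI)
    fix V assume "openin (quot_topology X q) V"
    then have V: "V \<subseteq> q ` topspace X" "openin X {x \<in> topspace X. q x \<in> V}"
      by (simp_all add: openin_quot_topology)
    have "\<Psi> ` V = f ` {x \<in> topspace X. q x \<in> V}"
      using V(1) eq by (force simp: image_iff)
    then show "openin Y (\<Psi> ` V)" using V(2) opn by (simp add: open_map_def)
  qed
  show "\<Psi> ` topspace (quot_topology X q) = topspace Y"
    using eq by (simp add: topspace_quot_topology image_image surj[symmetric] cong: image_cong)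
  show "inj_on \<Psi> (topspace (quot_topology X q))"
    using inj by (simp add: topspace_quot_topology)
qed

lemma openin_mat_iff:
  fixes H :: "(z2adic ^ 'n::finite ^ 'm::finite) set"
  shows "openin (top_of_set H) U \<longleftrightarrow>
    U \<subseteq> H \<and> (\<forall>X\<in>U. \<exists>n. \<forall>Y\<in>H. mat_cong n Y X \<longrightarrow> Y \<in> U)"
proof
  assume "openin (top_of_set H) U"
  then obtain W where "open W" "U = H \<inter> W" by (auto simp: openin_open)
  then show "U \<subseteq> H \<and> (\<forall>X\<in>U. \<exists>n. \<forall>Y\<in>H. mat_cong n Y X \<longrightarrow> Y \<in> U)"
    unfolding open_mat_iff by blast
next
  assume U: "U \<subseteq> H \<and> (\<forall>X\<in>U. \<exists>n. \<forall>Y\<in>H. mat_cong n Y X \<longrightarrow> Y \<in> U)"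
  then obtain N where N: "\<And>X Y. X \<in> U \<Longrightarrow> Y \<in> H \<Longrightarrow> mat_cong (N X) Y X \<Longrightarrow> Y \<in> U" by metis
  have "open (\<Union>X\<in>U. {Y. mat_cong (N X) Y X})"
    by (intro open_UN ballI open_mat_cong)
  moreover have "U = H \<inter> (\<Union>X\<in>U. {Y. mat_cong (N X) Y X})"
    using U N by auto
  ultimately show "openin (top_of_set H) U" unfolding openin_open by blast
qed

lemma open_z2adic_iff: "open (U :: z2adic set) \<longleftrightarrow> (\<forall>u\<in>U. \<exists>n. \<forall>w. 2 ^ n dvd w - u \<longrightarrow> w \<in> U)"
  unfolding open_z2adic_def residue_at_eq_iff ..

text \<open>Right multiplication by \<open>torus\<close> of the ratio of \<open>w\<close> to the
  multiplier of \<open>X\<close> adjusts the multiplier; the ratio is close to one, so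
  \<open>X\<close> hardly moves. With \<open>n = 1\<close> this gives surjectivity, with large
  \<open>n\<close> openness.\<close>

lemma (in full_preimage) mult_torus_in_H:
  assumes X: "X \<in> H" and w: "w dvd 1" "2 ^ n dvd w - multiplier X" and n: "n \<ge> 1"
  obtains Y where "Y \<in> H" "mat_cong n Y X" "red2_mat Y = red2_mat X" "multiplier Y = w"
proof -
  have XG: "X \<in> carrier GSp" using X by (rule H_subset)
  obtain c' where c': "1 = multiplier X * c'"
    using carrier_GSp_multiplier(2)[OF XG] by (elim dvdE)
  define t where "t = w * c'"
  have t: "t dvd 1"
    unfolding t_def using mult_dvd_mono[OF w(1), of c' 1] c' by (simp add: dvdI[of 1 c' "multiplier X"] mult.commute)
  have "t - 1 = (w - multiplier X) * c'" using c' by (simp add: t_def left_diff_distrib)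
  then have "2 ^ n dvd t - 1" using w(2) by simp
  then have cong: "mat_cong n (torus t) (mat 1)"
    by (auto simp: mat_cong_def torus_def mat_def split: sum.split)
  have "mat_cong n (X ** torus t) (X ** mat 1)"
    using cong by (intro mat_cong_mult) auto
  then have *: "mat_cong n (X ** torus t) X" by simp
  then have red: "red2_mat (X ** torus t) = red2_mat X" using n by (rule mat_cong_imp_red2_eq)
  have "X ** torus t \<in> carrier GSp"
    using m_closed[OF XG torus_in_GSp[OF t]] by simp
  then have H: "X ** torus t \<in> H" using red X by (intro full) auto
  have "multiplier (X ** torus t) = multiplier X * t"
    using multiplier_mult[OF XG torus_in_GSp[OF t]]
    by (simp add: multiplier_eqI[OF is_multiplier_torus])
  also have "\<dots> = (multiplier X * c') * w" by (simp add: t_def mult_ac)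
  finally have "multiplier (X ** torus t) = w" by (simp flip: c')
  then show thesis using H * red that by blast
qed

theorem theorem2p2:
  fixes H :: "(z2adic ^ ('g::finite + 'g) ^ ('g + 'g)) set"
    and \<iota> :: "(bit ^ 'm::finite) set \<Rightarrow> bit ^ ('g + 'g)"
    and l :: 'm
  defines "H2 \<equiv> red2_mat ` H"
  defines "G \<equiv> GSp\<lparr>carrier := H\<rparr>"
    and "G2 \<equiv> GSp\<lparr>carrier := H2\<rparr>"
    and "T \<equiv> top_of_set H"
    and "T2 \<equiv> discrete_topology H2"
  defines "\<Phi> \<equiv> \<lambda>S. (ab_class T2 G2 (red2_mat S), multiplier S)"
  assumes "CARD('g) \<ge> 2"
    and "CARD('m) = 2 * CARD('g) + 2"
    and "symp_identification \<iota>"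
    and "subgroup H GSp"
    and "H = {S \<in> carrier GSp. red2_mat S \<in> H2}"
    and "sym_stabilizer \<iota> l \<subseteq> H2"
  shows "top_derived T G = {S \<in> carrier Sp. red2_mat S \<in> top_derived T2 G2} \<and>
    \<Phi> \<in> hom G (top_ab T2 G2 \<times>\<times> z2_units) \<and>
    (\<exists>\<Psi>. \<Psi> \<in> iso (top_ab T G) (top_ab T2 G2 \<times>\<times> z2_units) \<and>
         homeomorphic_map (ab_topology T G)
           (prod_topology (ab_topology T2 G2) z2_units_topology) \<Psi> \<and>
         (\<forall>S\<in>H. \<Psi> (ab_class T G S) = \<Phi> S))"
proof -
  interpret full_preimage_sym H \<iota> l
  proof (intro full_preimage_sym.intro full_preimage.intro symplectic_W.intro
      full_preimage_sym_axioms.intro)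
    show "sym_stabilizer \<iota> l \<subseteq> red2_mat ` H"
      using \<open>sym_stabilizer \<iota> l \<subseteq> H2\<close> unfolding H2_def .
    fix S :: "z2adic ^ ('g + 'g) ^ ('g + 'g)"
    assume "S \<in> carrier GSp" "red2_mat S \<in> red2_mat ` H"
    then have "S \<in> {S \<in> carrier GSp. red2_mat S \<in> H2}" unfolding H2_def by blast
    then show "S \<in> H" by (simp only: \<open>H = {S \<in> carrier GSp. red2_mat S \<in> H2}\<close>[symmetric])
  qed fact+
  interpret GSp2: group "GSp :: (bit ^ ('g + 'g) ^ ('g + 'g)) monoid" by (rule group_GSp)
  have sub2: "subgroup H2 GSp" unfolding H2_def by (rule subgroup_red2_H)
  interpret G: group G unfolding G_def by (rule subgroup_imp_group[OF subgroup_H])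
  interpret G2: group G2 unfolding G2_def by (rule GSp2.subgroup_imp_group[OF sub2])
  define N2 where "N2 = derived GSp H2"
  have derG: "derived G (carrier G) = DH"
    unfolding G_def using derived_consistent[OF subset_refl subgroup_H] by simp
  have derG2: "derived G2 (carrier G2) = N2"
    unfolding G2_def N2_def using GSp2.derived_consistent[OF subset_refl sub2] by simp
  have N2_sub: "N2 \<subseteq> H2" unfolding N2_def by (rule GSp2.derived_incl[OF subset_refl sub2])
  \<comment> \<open>In the discrete topology taking the closure changes nothing.\<close>
  have N2: "top_derived T2 G2 = N2"
    using N2_sub unfolding top_derived_def derG2 T2_def by (simp add: closure_of_eq)
  have N: "top_derived T G = {S \<in> carrier Sp. red2_mat S \<in> N2}"
    unfolding top_derived_def derG T_def N2_def H2_def by (rule closure_of_DH)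

  \<comment> \<open>The homomorphism \<open>\<Phi>\<close>, its image and its kernel\<close>
  interpret N2: normal N2 G2 using G2.derived_self_is_normal unfolding derG2 .
  define Q where "Q = top_ab T2 G2 \<times>\<times> z2_units"
  have top_ab2: "top_ab T2 G2 = G2 Mod N2" by (simp add: top_ab_def N2)
  have Q: "group Q"
    unfolding Q_def top_ab2
    by (intro DirProd_group N2.factorgroup_is_group comm_group.axioms(2) comm_group_z2_units)
  define q2 where "q2 = ab_class T2 G2"
  have q2: "q2 x = N2 #>\<^bsub>G2\<^esub> x" for x by (simp add: q2_def ab_class_def N2)
  have \<Phi>: "\<Phi> S = (q2 (red2_mat S), multiplier S)" for S by (simp add: \<Phi>_def q2_def)
  have [simp]: "carrier G = H" "carrier G2 = H2" by (simp_all add: G_def G2_def)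
  have mG [simp]: "x \<otimes>\<^bsub>G\<^esub> y = x ** y" for x y by (simp add: G_def)
  have mG2 [simp]: "x \<otimes>\<^bsub>G2\<^esub> y = x ** y" for x y by (simp add: G2_def)
  have carrier_Q: "carrier Q = q2 ` H2 \<times> carrier z2_units"
    unfolding Q_def top_ab2 by (auto simp: FactGroup_def RCOSETS_def q2)
  have hom: "\<Phi> \<in> hom G Q"
  proof (rule homI)
    fix x assume "x \<in> carrier G"
    then show "\<Phi> x \<in> carrier Q"
      using carrier_GSp_multiplier(2)[OF H_subset, of x] by (auto simp: carrier_Q \<Phi> H2_def)
  next
    fix x y assume xy: "x \<in> carrier G" "y \<in> carrier G"
    then have "q2 (red2_mat (x ** y)) = q2 (red2_mat x) <#>\<^bsub>G2\<^esub> q2 (red2_mat y)"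
      using N2.rcos_sum[of "red2_mat x" "red2_mat y"] by (simp add: q2 H2_def)
    then show "\<Phi> (x \<otimes>\<^bsub>G\<^esub> y) = \<Phi> x \<otimes>\<^bsub>Q\<^esub> \<Phi> y"
      using xy multiplier_mult[OF H_subset H_subset, of x y]
      by (simp add: \<Phi> Q_def top_ab2 FactGroup_def DirProd_def)
  qed
  interpret \<Phi>: group_hom G Q \<Phi>
    unfolding group_hom_def group_hom_axioms_def using G.is_group Q hom by blast
  have surj: "\<Phi> ` H = q2 ` H2 \<times> carrier z2_units"
  proof (intro equalityI subsetI)
    fix p assume "p \<in> q2 ` H2 \<times> carrier z2_units"
    then obtain X w where X: "X \<in> H" "w dvd 1" "p = (q2 (red2_mat X), w)"
      by (auto simp: H2_def)
    \<comment> \<open>Every unit is odd, so any two units agree modulo two and the multiplier can be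
      corrected at level one.\<close>
    have unit_red: "red2 u = 1" if "u dvd 1" for u
    proof -
      obtain v where "1 = u * v" using \<open>u dvd 1\<close> by (elim dvdE)
      then have "red2 1 = red2 (u * v)" by simp
      then show ?thesis by (cases "red2 u") simp_all
    qed
    have "red2 (w - multiplier X) = 0"
      using unit_red[OF X(2)] unit_red[OF carrier_GSp_multiplier(2)[OF H_subset[OF X(1)]]] by simp
    then have "2 ^ 1 dvd w - multiplier X" by (simp only: red2_eq_0_iff power_one_right)
    then obtain Y where "Y \<in> H" "red2_mat Y = red2_mat X" "multiplier Y = w"
      using mult_torus_in_H[OF X(1,2)] by (metis order_refl)
    then show "p \<in> \<Phi> ` H" by (metis X(3) \<Phi> imageI)
  next
    fix p assume "p \<in> \<Phi> ` H"
    then obtain X where "X \<in> H" "p = \<Phi> X" by blast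
    then show "p \<in> q2 ` H2 \<times> carrier z2_units"
      using \<Phi>.hom_closed[of X] carrier_Q by simp
  qed
  \<comment> \<open>Triviality of the two components gives exactly the two conditions describing
    \<open>top_derived T G\<close>; membership in \<open>H\<close> follows from fullness.\<close>
  have ker: "kernel G Q \<Phi> = top_derived T G"
  proof -
    have one: "\<one>\<^bsub>Q\<^esub> = (N2, 1)" by (simp add: Q_def top_ab2 FactGroup_def DirProd_def)
    have "q2 x = N2 \<longleftrightarrow> x \<in> N2" if "x \<in> H2" for x
      unfolding q2 using that N2.subset
      by (metis G2.coset_join1 G2.coset_join2 N2.subgroup_axioms \<open>carrier G2 = H2\<close>)
    moreover have "S \<in> H" if "S \<in> carrier Sp" "red2_mat S \<in> N2" for S
      using that N2_sub by (intro full) (auto simp: carrier_Sp_iff H2_def)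
    ultimately show ?thesis
      unfolding kernel_def N one \<Phi> using H_subset by (auto simp: carrier_Sp_iff H2_def)
  qed
  define q where "q = ab_class T G"
  have q: "q x = kernel G Q \<Phi> #>\<^bsub>G\<^esub> x" for x by (simp add: q_def ab_class_def ker)
  define \<Psi> where "\<Psi> X = the_elem (\<Phi> ` X)" for X
  have iso: "\<Psi> \<in> iso (top_ab T G) Q"
    unfolding \<Psi>_def top_ab_def ker[symmetric]
    by (rule \<Phi>.FactGroup_iso_set) (simp add: surj carrier_Q)
  have eq: "\<Psi> (q S) = \<Phi> S" if "S \<in> H" for S
  proof -
    have "\<Phi> (k ** S) = \<Phi> S" if "k \<in> kernel G Q \<Phi>" for k
      using that \<open>S \<in> H\<close> \<Phi>.hom_mult[of k S] \<Phi>.hom_closed[of S] by (simp add: kernel_def)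
    moreover have "mat 1 \<in> kernel G Q \<Phi>"
      using subgroup.one_closed[OF \<Phi>.subgroup_kernel] by (simp add: G_def)
    moreover have "q S = (\<lambda>k. k ** S) ` kernel G Q \<Phi>" by (auto simp: q r_coset_def)
    ultimately have "\<Phi> ` q S = {\<Phi> S}"
      by (auto simp: image_image image_constant_conv cong: image_cong)
    then show ?thesis by (simp add: \<Psi>_def)
  qed

  \<comment> \<open>The induced isomorphism is a homeomorphism\<close>
  define U where "U = prod_topology (ab_topology T2 G2) z2_units_topology"
  have open2: "openin (ab_topology T2 G2) V \<longleftrightarrow> V \<subseteq> q2 ` H2" for V
    by (auto simp: ab_topology_def openin_quot_topology T2_def q2_def)
  have top2: "topspace (ab_topology T2 G2) = q2 ` H2"
    by (simp add: ab_topology_def topspace_quot_topology T2_def q2_def)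
  have cont: "continuous_map T U \<Phi>"
    unfolding U_def continuous_map_pairwise
  proof
    show "continuous_map T (ab_topology T2 G2) (fst \<circ> \<Phi>)"
      unfolding continuous_map T_def openin_mat_iff
    proof (intro conjI allI impI ballI)
      fix V X assume X: "X \<in> {X \<in> topspace (top_of_set H). (fst \<circ> \<Phi>) X \<in> V}"
      show "\<exists>n. \<forall>Y\<in>H. mat_cong n Y X \<longrightarrow> Y \<in> {X \<in> topspace (top_of_set H). (fst \<circ> \<Phi>) X \<in> V}"
      proof (intro exI ballI impI)
        \<comment> \<open>Level one suffices, since the first component depends only on the
          reduction modulo two.\<close>
        fix Y assume "Y \<in> H" "mat_cong 1 Y X"
        then show "Y \<in> {X \<in> topspace (top_of_set H). (fst \<circ> \<Phi>) X \<in> V}"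
          using X mat_cong_imp_red2_eq[of 1 Y X] by (simp add: \<Phi>)
      qed
    qed (auto simp: top2 \<Phi> H2_def)
    show "continuous_map T z2_units_topology (snd \<circ> \<Phi>)"
      unfolding continuous_map T_def openin_mat_iff
    proof (intro conjI allI impI ballI)
      fix V X assume "openin z2_units_topology V"
        and X: "X \<in> {X \<in> topspace (top_of_set H). (snd \<circ> \<Phi>) X \<in> V}"
      then obtain W where W: "open W" "V = carrier z2_units \<inter> W" by (auto simp: openin_open)
      then obtain n where n: "\<And>w. 2 ^ n dvd w - multiplier X \<Longrightarrow> w \<in> W"
        using X unfolding open_z2adic_iff by (auto simp: \<Phi>)
      have "multiplier Y \<in> V" if "Y \<in> H" "mat_cong n Y X" for Y
        using n[OF multiplier_cong[OF H_subset H_subset that(2)]] that X W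
          carrier_GSp_multiplier(2)[OF H_subset, of Y] by auto
      then show "\<exists>n. \<forall>Y\<in>H. mat_cong n Y X \<longrightarrow> Y \<in> {X \<in> topspace (top_of_set H). (snd \<circ> \<Phi>) X \<in> V}"
        by (auto simp: \<Phi>)
    qed (use carrier_GSp_multiplier(2)[OF H_subset] in \<open>auto simp: \<Phi>\<close>)
  qed
  have opn: "open_map T U \<Phi>"
    unfolding open_map_def
  proof (intro allI impI)
    fix V assume "openin T V"
    then have V: "V \<subseteq> H" "\<And>X. X \<in> V \<Longrightarrow> \<exists>n. \<forall>Y\<in>H. mat_cong n Y X \<longrightarrow> Y \<in> V"
      by (simp_all add: T_def openin_mat_iff)
    show "openin U (\<Phi> ` V)"
      unfolding U_def openin_prod_topology_alt
    proof (intro allI impI)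
      fix x y assume "(x, y) \<in> \<Phi> ` V"
      then obtain X where X: "X \<in> V" "x = q2 (red2_mat X)" "y = multiplier X" by (auto simp: \<Phi>)
      have XH: "X \<in> H" using X V by blast
      obtain n where n: "\<And>Y. Y \<in> H \<Longrightarrow> mat_cong n Y X \<Longrightarrow> Y \<in> V" using V(2)[OF X(1)] by blast
      \<comment> \<open>Precision \<open>n\<close> keeps the modified matrix inside
        \<open>V\<close>; the lower bound 1 keeps its reduction, and hence the first component,
        fixed.\<close>
      define m where "m = max n 1"
      define W where "W = {w. w dvd 1 \<and> 2 ^ m dvd w - multiplier X}"
      have "open {w. 2 ^ m dvd w - multiplier X}"
        unfolding open_z2adic_iff
      proof (intro ballI exI allI impI)
        fix u w assume "u \<in> {w. 2 ^ m dvd w - multiplier X}" "2 ^ m dvd w - u"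
        then have "2 ^ m dvd (w - u) + (u - multiplier X)" by (intro dvd_add) auto
        then show "w \<in> {w. 2 ^ m dvd w - multiplier X}" by simp
      qed
      moreover have "W = carrier z2_units \<inter> {w. 2 ^ m dvd w - multiplier X}"
        by (auto simp: W_def)
      ultimately have "openin z2_units_topology W" unfolding openin_open by blast
      moreover have "openin (ab_topology T2 G2) {x}" using XH by (auto simp: open2 X H2_def)
      moreover have "y \<in> W"
        using carrier_GSp_multiplier(2)[OF H_subset[OF XH]] by (simp add: W_def X)
      moreover have "{x} \<times> W \<subseteq> \<Phi> ` V"
      proof clarify
        fix w assume "w \<in> W"
        then obtain Y where Y: "Y \<in> H" "mat_cong m Y X" "red2_mat Y = red2_mat X" "multiplier Y = w"
          using mult_torus_in_H[OF XH, of w m] by (auto simp: W_def m_def)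
        then have "Y \<in> V" using n mat_cong_mono[OF Y(2), of n] by (simp add: m_def)
        moreover have "\<Phi> Y = (x, w)" using Y X by (simp add: \<Phi>)
        ultimately show "(x, w) \<in> \<Phi> ` V" by (metis imageI)
      qed
      ultimately show "\<exists>A B. openin (ab_topology T2 G2) A \<and> openin z2_units_topology B \<and>
          x \<in> A \<and> y \<in> B \<and> A \<times> B \<subseteq> \<Phi> ` V"
        by blast
    qed
  qed
  have "homeomorphic_map (ab_topology T G) U \<Psi>"
    unfolding ab_topology_def q_def[symmetric]
  proof (rule homeomorphic_map_quot_topology[OF cont opn])
    show "\<Phi> ` topspace T = topspace U"
      by (simp add: T_def U_def surj top2)
    show "\<Psi> (q x) = \<Phi> x" if "x \<in> topspace T" for x using that eq by (simp add: T_def)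
    have "q ` topspace T = carrier (top_ab T G)"
      by (auto simp: T_def q top_ab_def ker FactGroup_def RCOSETS_def)
    then show "inj_on \<Psi> (q ` topspace T)"
      using iso by (simp add: iso_def bij_betw_def)
  qed
  then show ?thesis
    using N N2 hom iso eq unfolding Q_def U_def q_def by blast
qed

end
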